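(* Let $\Gamma$ be an equilateral metric graph that is a cycle with an odd number $n$ of vertices, with transition matrix $\mathcal{Z}$, and let $\widetilde{\Gamma}$ be an equilateral bipartite metric graph obtained by adding some vertices in the middle of each edge of $\Gamma$. Let $\mu_1\geq\mu_2\geq\cdots\geq\mu_n$ be the eigenvalues of $\mathcal{Z}$ counted with multiplicity. If $$\mu_j\leq-\mu_{n+2-j}\ \text{ for all } 2\leq j\leq n\qquad\text{and}\qquad \mu_j\geq-\mu_{n-j}\ \text{ for all } 2\leq j\leq n-2,$$ then $$\lambda_{k+1}(L^{a/st}(\widetilde{\Gamma}))\geq\lambda_k(L^{a/st}(\Gamma))\quad\text{for all } k\in\mathbb{N}.$$
   Context: A metric graph $\Gamma$ consists of a finite vertex set $\mathcal{V}=\{v_1,\dots,v_n\}$ and a finite nonempty edge set $\mathcal{E}=\{e_1,\dots,e_N\}$; it is connected and simple (no loops, at most one edge between two vertices), and each edge $e_i$ has a length $l_{e_i}\in(0,\infty)$ and is identified with the interval $[0,l_{e_i}]$ (the endpoints $0$ and $l_{e_i}$ corresponding to the two vertices of $e_i$). $\Gamma$ is equilateral if all edges have the same length. $\Gamma$ is bipartite if $\mathcal{V}$ is the disjoint union of two sets such that every edge has one endpoint in each. Adding vertices in the middle of an edge means subdividing it: the edge is replaced by a path of consecutive edges whose lengths sum to the length of the original edge, the new vertices having degree $2$. The adjacency matrix $\mathcal{A}=(a_{ij})_{n\times n}$ has $a_{ij}=1$ if $v_i,v_j$ are joined by an edge and $a_{ij}=0$ otherwise. The transition matrix is $\mathcal{Z}=\mathrm{Diag}(\mathcal{A}e)^{-1}\mathcal{A}$,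 where $e=(1,\dots,1)^{\top}\in\mathbb{R}^n$; its eigenvalues are real. $L^2(\Gamma)=\bigoplus_i L^2[0,l_{e_i}]$, and $f_i$ denotes the restriction of $f$ to $e_i$. The maximal domain consists of all $f\in L^2(\Gamma)$ with $f_i,f_i'$ absolutely continuous on $[0,l_{e_i}]$ for every $i$ and $-f''\in L^2(\Gamma)$. The anti-standard Laplace operator $L^{a/st}(\Gamma)$ acts by $f\mapsto -f''$ on each edge, with domain the functions $f$ in the maximal domain such that at every vertex $v$ (including the added vertices, in the case of $\widetilde\Gamma$) the derivatives of $f$ at $v$ along all incident edges, taken in the direction outgoing from $v$, coincide, and the sum over incident edges of the values of $f$ at $v$ is $0$. Its spectrum consists of isolated nonnegative eigenvalues of finite multiplicity; $\lambda_1(\cdot)\leq\lambda_2(\cdot)\leq\cdots$ denotes the eigenvalues in nondecreasing order counted with multiplicity, and $\mathbb{N}=\{1,2,3,\dots\}$. *)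

theory Defs
  imports "HOL-Analysis.Analysis" "HOL-Library.Function_Algebras"
    "Jordan_Normal_Form.Char_Poly" "Jordan_Normal_Form.Gauss_Jordan_Elimination"
begin

section \<open>Metric graphs\<close>

text \<open>The edge \<open>(u, v)\<close> stands for the undirected edge joining \<open>u\<close> and \<open>v\<close>, identified with
  the interval \<open>[0, l]\<close> in such a way that \<open>0\<close> corresponds to \<open>u\<close> and \<open>l\<close> to \<open>v\<close>.
  The list of vertices fixes the numbering of the rows and columns of the matrices of the graph.\<close>

record 'v mgraph =
  vertices :: "'v list"
  edges :: "('v \<times> 'v) set"
  edge_len :: "'v \<times> 'v \<Rightarrow> real"

definition adjacent :: "'v mgraph \<Rightarrow> 'v \<Rightarrow> 'v \<Rightarrow> bool" where
  "adjacent G u v \<longleftrightarrow> (u, v) \<in> edges G \<or> (v, u) \<in> edges G"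

text \<open>As each undirected edge is represented by a single ordered pair, asymmetry of the edge
  relation excludes both loops and multiple edges.\<close>

definition metric_graph :: "'v mgraph \<Rightarrow> bool" where
  "metric_graph G \<longleftrightarrow>
     distinct (vertices G) \<and>
     edges G \<noteq> {} \<and>
     edges G \<subseteq> set (vertices G) \<times> set (vertices G) \<and>
     (\<forall>u v. (u, v) \<in> edges G \<longrightarrow> (v, u) \<notin> edges G) \<and>
     (\<forall>u \<in> set (vertices G). \<forall>v \<in> set (vertices G). (adjacent G)\<^sup>*\<^sup>* u v) \<and>
     (\<forall>e \<in> edges G. 0 < edge_len G e)"

definition equilateral :: "'v mgraph \<Rightarrow> bool" where
  "equilateral G \<longleftrightarrow> (\<exists>l. \<forall>e \<in> edges G. edge_len G e = l)"

definition bipartite :: "'v mgraph \<Rightarrow> bool" where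
  "bipartite G \<longleftrightarrow> (\<exists>A B. A \<union> B = set (vertices G) \<and> A \<inter> B = {} \<and>
     (\<forall>(u, v) \<in> edges G. u \<in> A \<and> v \<in> B \<or> u \<in> B \<and> v \<in> A))"

definition is_cycle :: "'v mgraph \<Rightarrow> bool" where
  "is_cycle G \<longleftrightarrow> (\<exists>cs. 3 \<le> length cs \<and> distinct cs \<and> set cs = set (vertices G) \<and>
     (\<forall>u v. adjacent G u v \<longleftrightarrow>
        (\<exists>i < length cs. {u, v} = {cs ! i, cs ! (Suc i mod length cs)})))"


section \<open>Adding vertices in the middle of each edge\<close>

definition joining_len :: "'v mgraph \<Rightarrow> 'v \<times> 'v \<Rightarrow> real" where
  "joining_len G = (\<lambda>(u, v). if (u, v) \<in> edges G then edge_len G (u, v) else edge_len G (v, u))"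

definition path_steps :: "'v list \<Rightarrow> ('v \<times> 'v) list" where
  "path_steps p = zip p (tl p)"

definition inner_vertices :: "'v list \<Rightarrow> 'v set" where
  "inner_vertices p = set p - {hd p, last p}"

text \<open>\<open>\<phi>\<close> embeds the vertices of \<open>G\<close> into those of \<open>H\<close>, and the edge \<open>e\<close> of \<open>G\<close> is replaced by
  the path \<open>P e\<close> of \<open>H\<close>, which has at least one inner (that is, added) vertex.\<close>

definition subdivides_each_edge :: "'w mgraph \<Rightarrow> 'v mgraph \<Rightarrow> bool" where
  "subdivides_each_edge H G \<longleftrightarrow> (\<exists>\<phi> P.
     inj_on \<phi> (set (vertices G)) \<and>
     set (vertices H) = \<phi> ` set (vertices G) \<union> (\<Union>e \<in> edges G. inner_vertices (P e)) \<and>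
     (\<forall>e \<in> edges G.
        3 \<le> length (P e) \<and> distinct (P e) \<and>
        hd (P e) = \<phi> (fst e) \<and> last (P e) = \<phi> (snd e) \<and>
        inner_vertices (P e) \<inter> \<phi> ` set (vertices G) = {} \<and>
        edge_len G e = (\<Sum>s \<leftarrow> path_steps (P e). joining_len H s)) \<and>
     (\<forall>e \<in> edges G. \<forall>e' \<in> edges G. e \<noteq> e' \<longrightarrow>
        inner_vertices (P e) \<inter> inner_vertices (P e') = {}) \<and>
     (\<forall>x y. adjacent H x y \<longleftrightarrow>
        (\<exists>e \<in> edges G. (x, y) \<in> set (path_steps (P e)) \<or> (y, x) \<in> set (path_steps (P e)))))"


section \<open>Adjacency and transition matrix\<close>

definition adjacency_matrix :: "'v mgraph \<Rightarrow> real mat" where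
  "adjacency_matrix G =
     (let n = length (vertices G)
      in mat n n (\<lambda>(i, j). if adjacent G (vertices G ! i) (vertices G ! j) then 1 else 0))"

text \<open>In a connected graph with an edge no row sum vanishes, so the inverse exists.\<close>

definition transition_matrix :: "'v mgraph \<Rightarrow> real mat" where
  "transition_matrix G =
     (let n = length (vertices G);
          A = adjacency_matrix G;
          d = A *\<^sub>v vec n (\<lambda>_. 1)
      in the (mat_inverse (mat_diag n (vec_index d))) * A)"

text \<open>\<open>\<mu> 1 \<ge> \<dots> \<ge> \<mu> n\<close> are the eigenvalues of the \<open>n \<times> n\<close> matrix \<open>M\<close>, counted with multiplicity.\<close>

definition matrix_eigenvalues_desc :: "real mat \<Rightarrow> (nat \<Rightarrow> real) \<Rightarrow> bool" where
  "matrix_eigenvalues_desc M \<mu> \<longleftrightarrow>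
     char_poly M = (\<Prod>j = 1..dim_row M. [:- \<mu> j, 1:]) \<and>
     antimono_on {1..dim_row M} \<mu>"


section \<open>The anti-standard Laplace operator\<close>

text \<open>The usual \<open>\<epsilon>\<close>-\<open>\<delta>\<close> definition; \<open>D\<close> is a finite family of non-overlapping closed
  subintervals \<open>K = [Inf K, Sup K]\<close> of \<open>S\<close>.\<close>

definition abs_continuous_on :: "real set \<Rightarrow> (real \<Rightarrow> 'a::real_normed_vector) \<Rightarrow> bool" where
  "abs_continuous_on S f \<longleftrightarrow> (\<forall>\<epsilon> > 0. \<exists>\<delta> > 0. \<forall>D T. D division_of T \<and> T \<subseteq> S \<and>
     (\<Sum>K\<in>D. Sup K - Inf K) < \<delta> \<longrightarrow> (\<Sum>K\<in>D. norm (f (Sup K) - f (Inf K))) < \<epsilon>)"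

definition square_integrable_on :: "real set \<Rightarrow> (real \<Rightarrow> complex) \<Rightarrow> bool" where
  "square_integrable_on S f \<longleftrightarrow> f \<in> borel_measurable (lebesgue_on S) \<and>
     integrable (lebesgue_on S) (\<lambda>x. (cmod (f x))\<^sup>2)"

type_synonym 'v graph_fun = "'v \<times> 'v \<Rightarrow> real \<Rightarrow> complex"

definition edge_deriv :: "'v mgraph \<Rightarrow> 'v graph_fun \<Rightarrow> 'v graph_fun" where
  "edge_deriv G f e x = vector_derivative (f e) (at x within {0..edge_len G e})"

definition neg_laplace :: "'v mgraph \<Rightarrow> 'v graph_fun \<Rightarrow> 'v graph_fun" where
  "neg_laplace G f e x = - edge_deriv G (edge_deriv G f) e x"

text \<open>An element of the maximal domain is represented by its unique representative that is
  continuous on every edge, extended by \<open>0\<close> outside of the edge intervals; the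
  extension makes the representation unique, so that dimensions are those in \<open>L\<^sup>2\<close>.
  Absolute continuity of \<open>f'\<close> on the whole of \<open>[0, l]\<close> makes \<open>f\<close> continuously differentiable
  there, whereas \<open>f''\<close> exists only almost everywhere (elsewhere \<open>vector_derivative\<close> is
  arbitrary).\<close>

definition maximal_domain :: "'v mgraph \<Rightarrow> 'v graph_fun set" where
  "maximal_domain G = {f.
     (\<forall>e x. e \<notin> edges G \<or> x \<notin> {0..edge_len G e} \<longrightarrow> f e x = 0) \<and>
     (\<forall>e \<in> edges G.
        square_integrable_on {0..edge_len G e} (f e) \<and>
        abs_continuous_on {0..edge_len G e} (f e) \<and>
        f e differentiable_on {0..edge_len G e} \<and>
        abs_continuous_on {0..edge_len G e} (edge_deriv G f e) \<and>
        square_integrable_on {0..edge_len G e} (neg_laplace G f e))}"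

definition incident_edges :: "'v mgraph \<Rightarrow> 'v \<Rightarrow> ('v \<times> 'v) set" where
  "incident_edges G v = {e \<in> edges G. v = fst e \<or> v = snd e}"

definition vertex_value :: "'v mgraph \<Rightarrow> 'v graph_fun \<Rightarrow> 'v \<Rightarrow> 'v \<times> 'v \<Rightarrow> complex" where
  "vertex_value G f v e = (if v = fst e then f e 0 else f e (edge_len G e))"

definition outgoing_deriv :: "'v mgraph \<Rightarrow> 'v graph_fun \<Rightarrow> 'v \<Rightarrow> 'v \<times> 'v \<Rightarrow> complex" where
  "outgoing_deriv G f v e =
     (if v = fst e then edge_deriv G f e 0 else - edge_deriv G f e (edge_len G e))"

definition anti_standard_domain :: "'v mgraph \<Rightarrow> 'v graph_fun set" where
  "anti_standard_domain G = {f \<in> maximal_domain G. \<forall>v \<in> set (vertices G).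
     (\<forall>e \<in> incident_edges G v. \<forall>e' \<in> incident_edges G v.
        outgoing_deriv G f v e = outgoing_deriv G f v e') \<and>
     (\<Sum>e \<in> incident_edges G v. vertex_value G f v e) = 0}"

definition anti_standard_eigenspace :: "'v mgraph \<Rightarrow> real \<Rightarrow> 'v graph_fun set" where
  "anti_standard_eigenspace G t = {f \<in> anti_standard_domain G. \<forall>e \<in> edges G.
     AE x in lebesgue_on {0..edge_len G e}. neg_laplace G f e x = complex_of_real t * f e x}"

definition graph_fun_scale :: "complex \<Rightarrow> 'v graph_fun \<Rightarrow> 'v graph_fun" where
  "graph_fun_scale c f = (\<lambda>e x. c * f e x)"

interpretation graph_fun: vector_space graph_fun_scale
  by unfold_locales (auto simp: graph_fun_scale_def fun_eq_iff algebra_simps)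

text \<open>\<open>s 1 \<le> s 2 \<le> \<dots>\<close> lists the eigenvalues in nondecreasing order, each as many times as
  its multiplicity. Finite dimension is required explicitly because \<open>dim\<close> of an
  infinite-dimensional space is \<open>0\<close>.\<close>

definition anti_standard_eigenvalue_seq :: "'v mgraph \<Rightarrow> (nat \<Rightarrow> real) \<Rightarrow> bool" where
  "anti_standard_eigenvalue_seq G s \<longleftrightarrow>
     mono_on {1..} s \<and>
     (\<forall>t. (\<exists>B. finite B \<and> anti_standard_eigenspace G t \<subseteq> graph_fun.span B) \<and>
          finite {k. 1 \<le> k \<and> s k = t} \<and>
          card {k. 1 \<le> k \<and> s k = t} = graph_fun.dim (anti_standard_eigenspace G t))"

text \<open>The sequence is unique up to its irrelevant value at \<open>0\<close>.\<close>

definition anti_standard_eigenvalue :: "'v mgraph \<Rightarrow> nat \<Rightarrow> real" where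
  "anti_standard_eigenvalue G k = (SOME s. anti_standard_eigenvalue_seq G s) k"

end

theory Submission
  imports Defs
begin

text \<open>On a cycle the anti-standard conditions say that, up to a change of sign at every vertex, an
  eigenfunction is a solution of \<open>u'' = - t u\<close> running around a circle of length \<open>L\<close>, the total
  length. After one turn the sign is \<open>(- 1) ^ N\<close> for \<open>N\<close> vertices, so the solution is antiperiodic on
  \<open>\<Gamma>\<close>, and periodic on the bipartite cycle \<open>\<Gamma>'\<close> of the same length. The eigenvalues are thus
  \<open>((2 m + 1) \<pi> / L)\<^sup>2\<close> for \<open>m \<ge> 0\<close>, all double, and \<open>(2 m \<pi> / L)\<^sup>2\<close>, double except for the simple
  eigenvalue \<open>0\<close>, and the inequality can be read off.

  That eigenfunctions are classical solutions rests on Lebesgue's theorem that absolutely continuous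
  functions are differentiable almost everywhere and are recovered by integrating their
  derivatives. A function of bounded variation is a difference of monotone ones; for these the theorem
  comes from the Radon-Nikodym derivative of the associated Stieltjes measure.\<close>

section \<open>Absolutely continuous functions\<close>

text \<open>At a vertex of degree 2 both \<open>u\<close> and \<open>u'\<close> flip when it is
  passed: the two values add up to 0, and one of the two equal outgoing derivatives is taken against
  the direction of travel. So the only global condition is that the transfer matrix over the length
  \<open>L\<close> has the eigenvalue \<open>(- 1) ^ N\<close>. That matrix has determinant 1, and
  when it has this eigenvalue it is a multiple of the identity, except at \<open>t = 0\<close>,
  where it is a shear. The obstacle is analytic. An equation for \<open>f''\<close> that holds
  almost everywhere says little by itself: for \<open>t = 0\<close> a Cantor-like \<open>f'\<close>
  would satisfy it too. Absolute continuity is phrased by endpoint increments over finite divisions,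
  so variation is measured along finite sorted lists, whose points refine a division without
  increasing its total length. The ordered eigenvalues are defined by a choice, so the explicit
  sequences need a proof that multiplicities determine a nondecreasing sequence.\<close>

fun list_variation :: "(real \<Rightarrow> real) \<Rightarrow> real list \<Rightarrow> real" where
  "list_variation g (x # y # xs) = \<bar>g y - g x\<bar> + list_variation g (y # xs)"
| "list_variation g xs = 0"

lemma list_variation_append:
  "list_variation g (xs @ b # ys) = list_variation g (xs @ [b]) + list_variation g (b # ys)"
proof (induction xs)
  case (Cons x xs)
  then show ?case by (cases xs) auto
qed auto

text \<open>The triangle inequality: between two neighbours one increment is replaced by two that
  add up to it, and at either end a nonnegative term is added.\<close>

lemma list_variation_insert: "list_variation g (xs @ ys) \<le> list_variation g (xs @ b # ys)"
proof (induction xs)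
  case Nil
  show ?case by (cases ys) auto
next
  case (Cons x xs)
  show ?case
  proof (cases xs)
    case Nil
    then show ?thesis by (cases ys) auto
  next
    case (Cons z zs)
    with Cons.IH show ?thesis by auto
  qed
qed

section \<open>Divisions cut out by sorted lists\<close>

text \<open>Pairs of equal points are skipped so that every cell has nonempty interior; cells with
  disjoint interiors are then different sets, as a sum over a set of intervals requires.\<close>

fun cells :: "real list \<Rightarrow> real set set" where
  "cells (x # y # xs) = (if x < y then insert {x..y} (cells (y # xs)) else cells (y # xs))"
| "cells xs = {}"

lemma finite_cells [simp]: "finite (cells xs)"
  by (induction xs rule: cells.induct) auto

lemma cellsE:
  assumes "K \<in> cells xs"
  obtains x y where "K = {x..y}" "x < y" "x \<in> set xs" "y \<in> set xs"
  using assms by (induction xs arbitrary: thesis rule: cells.induct) (auto split: if_splits)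

lemma cells_interior_disjoint:
  assumes "sorted xs" "K \<in> cells xs" "K' \<in> cells xs" "K \<noteq> K'"
  shows "interior K \<inter> interior K' = {}"
proof -
  have *: "interior {x..y} \<inter> interior C = {}" if "sorted (y # zs)" "C \<in> cells (y # zs)" for x y zs C
  proof -
    from that(2) obtain u v where "C = {u..v}" "u \<in> set (y # zs)" by (auto elim: cellsE)
    then show ?thesis using that(1) by auto
  qed
  show ?thesis using assms
  proof (induction xs rule: cells.induct)
    case (1 x y xs)
    note IH = this(1,2) and prems = this(3-)
    show ?case
    proof (cases "x < y")
      case True
      then consider "K \<in> cells (y # xs)" "K' \<in> cells (y # xs)"
        | "K = {x..y}" "K' \<in> cells (y # xs)" | "K \<in> cells (y # xs)" "K' = {x..y}"
        using 1 by auto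
      then show ?thesis
      proof cases
        case 1
        then show ?thesis using IH prems True by simp
      next
        case 2
        then show ?thesis using *[of y xs K' x] prems by simp
      next
        case 3
        then show ?thesis using *[of y xs K x] prems by auto
      qed
    next
      case False
      then show ?thesis using 1 by simp
    qed
  qed auto
qed

text \<open>A skipped pair has increment 0 and no cell occurs twice, so no term is lost in passing
  from the list to a set of intervals.\<close>

lemma cells_sum:
  assumes "sorted xs"
  shows "(\<Sum>K\<in>cells xs. \<bar>g (Sup K) - g (Inf K)\<bar>) = list_variation g xs"
  using assms
proof (induction xs rule: cells.induct)
  case (1 x y xs)
  have "{x..y} \<notin> cells (y # xs)" if "x < y"
  proof
    assume "{x..y} \<in> cells (y # xs)"
    then obtain u v where "{x..y} = {u..v}" "u < v" "u \<in> set (y # xs)" by (rule cellsE)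
    with 1 that show False by auto
  qed
  with 1 show ?case by auto
qed auto

text \<open>The instance of \<open>cells_sum\<close> for the identity, whose variation along a
  sorted list telescopes.\<close>

lemma cells_length:
  assumes "sorted xs" "xs \<noteq> []"
  shows "(\<Sum>K\<in>cells xs. Sup K - Inf K) = last xs - hd xs"
proof -
  have "(\<Sum>K\<in>cells xs. Sup K - Inf K) = list_variation (\<lambda>x. x) xs"
    by (subst cells_sum[OF assms(1), symmetric])
      (auto intro!: sum.cong elim!: cellsE)
  also have "\<dots> = last xs - hd xs"
    using assms by (induction xs rule: cells.induct) (force split: if_splits)+
  finally show ?thesis .
qed

text \<open>Absolute continuity speaks only of increments between endpoints. Cutting each interval
  \<open>K\<close> at the points of \<open>L K\<close> gives another division, no longer in total,
  whose endpoint increments make up the variation along the lists; so the same \<delta> serves for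
  both.\<close>

lemma refined_division:
  assumes D: "D division_of T"
    and L: "\<And>K. K \<in> D \<Longrightarrow> sorted (L K) \<and> set (L K) \<subseteq> K"
  shows "\<exists>E U. E division_of U \<and> U \<subseteq> T \<and>
    (\<Sum>K\<in>E. Sup K - Inf K) \<le> (\<Sum>K\<in>D. Sup K - Inf K) \<and>
    (\<Sum>K\<in>E. \<bar>g (Sup K) - g (Inf K)\<bar>) = (\<Sum>K\<in>D. list_variation g (L K))"
proof -
  define E where "E = (\<Union>K\<in>D. cells (L K))"
  have fin: "finite D" using D by auto
  have conv: "\<exists>a b. K = {a..b} \<and> a \<le> b" if "K \<in> D" for K
    using D that by (metis box_real(2) division_ofD(3,4) atLeastatMost_empty_iff2)
  have sub: "C \<subseteq> K" if K: "K \<in> D" and C: "C \<in> cells (L K)" for K C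
  proof -
    obtain x y where "C = {x..y}" "x \<in> set (L K)" "y \<in> set (L K)" using cellsE[OF C] by metis
    with L[OF K] have "x \<in> K" "y \<in> K" by auto
    with \<open>C = {x..y}\<close> conv[OF K] show ?thesis by auto
  qed
  have int_ne: "interior C \<noteq> {}" if C: "C \<in> cells xs" for C xs
  proof -
    obtain x y where "C = {x..y}" "x < y" using cellsE[OF C] by metis
    then show ?thesis by auto
  qed
  have djK: "interior C \<inter> interior C' = {}"
    if "K \<in> D" "K' \<in> D" "K \<noteq> K'" "C \<in> cells (L K)" "C' \<in> cells (L K')" for K K' C C'
    using division_ofD(5)[OF D that(1-3)] interior_mono[OF sub[OF that(1,4)]]
      interior_mono[OF sub[OF that(2,5)]] by blast
  have dj: "cells (L K) \<inter> cells (L K') = {}" if "K \<in> D" "K' \<in> D" "K \<noteq> K'" for K K'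
    using djK[OF that] int_ne by (metis Int_absorb disjoint_iff)
  have sumE: "(\<Sum>C\<in>E. h C) = (\<Sum>K\<in>D. \<Sum>C\<in>cells (L K). h C)" for h :: "real set \<Rightarrow> real"
    unfolding E_def by (rule sum.UNION_disjoint) (use fin dj in auto)
  have "E division_of \<Union>E"
  proof (rule division_ofI)
    show "finite E" using fin by (auto simp: E_def)
    show "K \<subseteq> \<Union>E" if "K \<in> E" for K using that by auto
    show "K \<noteq> {}" if "K \<in> E" for K
      using that int_ne unfolding E_def by (metis UN_E interior_empty)
    show "\<exists>a b. K = cbox a b" if "K \<in> E" for K
      using that unfolding E_def by (auto elim!: cellsE)
    show "interior K1 \<inter> interior K2 = {}" if K12: "K1 \<in> E" "K2 \<in> E" and "K1 \<noteq> K2" for K1 K2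
    proof -
      obtain K K' where K: "K \<in> D" "K1 \<in> cells (L K)" "K' \<in> D" "K2 \<in> cells (L K')"
        using K12 unfolding E_def by blast
      show ?thesis
      proof (cases "K = K'")
        case True
        then show ?thesis using K L \<open>K1 \<noteq> K2\<close> cells_interior_disjoint by metis
      next
        case False
        then show ?thesis using K djK by metis
      qed
    qed
  qed auto
  moreover have "\<Union>E \<subseteq> T"
    using sub division_ofD(2)[OF D] unfolding E_def by blast
  moreover have "(\<Sum>K\<in>E. Sup K - Inf K) \<le> (\<Sum>K\<in>D. Sup K - Inf K)"
    unfolding sumE
  proof (rule sum_mono)
    fix K assume K: "K \<in> D"
    obtain a b where ab: "K = {a..b}" "a \<le> b" using conv[OF K] by blast
    show "(\<Sum>C\<in>cells (L K). Sup C - Inf C) \<le> Sup K - Inf K"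
    proof (cases "L K = []")
      case True
      with ab show ?thesis by simp
    next
      case False
      then have "hd (L K) \<in> K" "last (L K) \<in> K" using L[OF K] by auto
      then show ?thesis using cells_length[of "L K"] L[OF K] False ab by auto
    qed
  qed
  moreover have "(\<Sum>K\<in>E. \<bar>g (Sup K) - g (Inf K)\<bar>) = (\<Sum>K\<in>D. list_variation g (L K))"
    unfolding sumE by (intro sum.cong refl cells_sum) (use L in auto)
  ultimately show ?thesis by blast
qed

lemma abs_continuous_on_list_variation:
  assumes "abs_continuous_on S g" "(0::real) < \<epsilon>"
  shows "\<exists>\<delta>>0. \<forall>D T L. D division_of T \<and> T \<subseteq> S \<and> (\<Sum>K\<in>D. Sup K - Inf K) < \<delta> \<and>
    (\<forall>K\<in>D. sorted (L K) \<and> set (L K) \<subseteq> K) \<longrightarrow> (\<Sum>K\<in>D. list_variation g (L K)) < \<epsilon>"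
proof -
  obtain \<delta> where "0 < \<delta>" and \<delta>: "\<forall>D T. D division_of T \<and> T \<subseteq> S \<and>
    (\<Sum>K\<in>D. Sup K - Inf K) < \<delta> \<longrightarrow> (\<Sum>K\<in>D. \<bar>g (Sup K) - g (Inf K)\<bar>) < \<epsilon>"
    using assms(1)[unfolded abs_continuous_on_def real_norm_def, rule_format, OF assms(2)] by blast
  show ?thesis
  proof (intro exI[of _ \<delta>] conjI allI impI \<open>0 < \<delta>\<close>)
    fix D T L
    assume D: "D division_of T \<and> T \<subseteq> S \<and> (\<Sum>K\<in>D. Sup K - Inf K) < \<delta> \<and>
      (\<forall>K\<in>D. sorted (L K) \<and> set (L K) \<subseteq> K)"
    then obtain E U where "E division_of U" "U \<subseteq> T"
      "(\<Sum>K\<in>E. Sup K - Inf K) \<le> (\<Sum>K\<in>D. Sup K - Inf K)"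
      "(\<Sum>K\<in>E. \<bar>g (Sup K) - g (Inf K)\<bar>) = (\<Sum>K\<in>D. list_variation g (L K))"
      using refined_division[of D T L g] by blast
    then show "(\<Sum>K\<in>D. list_variation g (L K)) < \<epsilon>"
      using \<delta>[rule_format, of E U] D by (auto dest: subset_trans)
  qed
qed

text \<open>Inserting \<open>c\<close> does not decrease the variation, so what happens on the two
  sides of \<open>c\<close> can be estimated separately.\<close>

lemma list_variation_split:
  assumes "sorted L"
  obtains xs ys where "sorted (xs @ [c])" "sorted (c # ys)" "set xs \<union> set ys = set L"
    "list_variation g L \<le> list_variation g (xs @ [c]) + list_variation g (c # ys)"
proof
  let ?xs = "filter (\<lambda>x. x \<le> c) L" and ?ys = "filter (\<lambda>x. \<not> x \<le> c) L"
  have "L = ?xs @ ?ys"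
    using assms
  proof (induction L)
    case (Cons z L)
    show ?case
    proof (cases "z \<le> c")
      case False
      then have "filter (\<lambda>x. x \<le> c) L = []" "filter (\<lambda>x. \<not> x \<le> c) L = L"
        using Cons.prems by (auto simp: filter_empty_conv filter_id_conv)
      with False show ?thesis by simp
    qed (use Cons in auto)
  qed auto
  then show "list_variation g L \<le> list_variation g (?xs @ [c]) + list_variation g (c # ?ys)"
    using list_variation_insert[of g ?xs ?ys c] list_variation_append[of g ?xs c ?ys] by simp
qed (use assms in \<open>auto simp: sorted_append sorted_wrt_filter\<close>)

lemma list_variation_singleton: "set L \<subseteq> {a} \<Longrightarrow> list_variation g L = 0"
  by (induction g L rule: list_variation.induct) auto

text \<open>With the \<delta> that belongs to 1, the interval falls into finitely many pieces
  shorter than \<delta>, and each of them adds less than 1 to the variation.\<close>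

lemma bounded_list_variation:
  assumes "abs_continuous_on {a..b} g"
  shows "\<exists>M. \<forall>L. sorted L \<and> set L \<subseteq> {a..b} \<longrightarrow> list_variation g L \<le> M"
proof -
  obtain \<delta> where "0 < \<delta>" and \<delta>: "\<forall>D T L. D division_of T \<and> T \<subseteq> {a..b} \<and>
    (\<Sum>K\<in>D. Sup K - Inf K) < \<delta> \<and> (\<forall>K\<in>D. sorted (L K) \<and> set (L K) \<subseteq> K) \<longrightarrow>
    (\<Sum>K\<in>D. list_variation g (L K)) < 1"
    using abs_continuous_on_list_variation[OF assms, of 1] by auto
  \<comment> \<open>Half of \<delta>, because the length of a piece has to be strictly below
    \<delta>.\<close>
  define \<eta> where "\<eta> = \<delta> / 2"
  have "0 < \<eta>" "\<eta> < \<delta>" using \<open>0 < \<delta>\<close> by (auto simp: \<eta>_def)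
  have *: "list_variation g L \<le> n" if "sorted L" "set L \<subseteq> {a..b} \<inter> {..a + real n * \<eta>}" for n L
    using that
  proof (induction n arbitrary: L)
    case 0
    then have "set L \<subseteq> {a}" by auto
    then show ?case by (simp add: list_variation_singleton)
  next
    case (Suc n)
    define c where "c = a + real n * \<eta>"
    show ?case
    proof (cases "c \<le> b")
      case False
      then have "list_variation g L \<le> n"
        using Suc by (intro Suc.IH) (auto simp: c_def)
      then show ?thesis by simp
    next
      case True
      have "a \<le> c" using \<open>0 < \<eta>\<close> by (simp add: c_def)
      obtain xs ys where L: "sorted (xs @ [c])" "sorted (c # ys)" "set xs \<union> set ys = set L"
        "list_variation g L \<le> list_variation g (xs @ [c]) + list_variation g (c # ys)"
        using list_variation_split[OF Suc.prems(1), of c g] by metis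
      have "list_variation g (xs @ [c]) \<le> n"
        using L(1,3) Suc.prems(2) True \<open>a \<le> c\<close>
        by (intro Suc.IH) (auto simp: c_def sorted_append)
      moreover have "list_variation g (c # ys) < 1"
      proof -
        let ?K = "{c..min b (c + \<eta>)}"
        have "c \<le> min b (c + \<eta>)" using True \<open>0 < \<eta>\<close> by simp
        then have div: "{?K} division_of ?K"
          by (metis atLeastatMost_empty_iff2 box_real(2) division_of_self)
        have "set ys \<subseteq> {..c + \<eta>}"
          using Suc.prems(2) L(3) by (auto simp: c_def algebra_simps)
        moreover have "set ys \<subseteq> {..b}"
          using Suc.prems(2) L(3) by auto
        ultimately have "set (c # ys) \<subseteq> ?K"
          using L(2) \<open>c \<le> min b (c + \<eta>)\<close> by auto
        then have "(\<Sum>K\<in>{?K}. list_variation g (c # ys)) < 1"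
          using \<open>a \<le> c\<close> \<open>c \<le> min b (c + \<eta>)\<close> \<open>\<eta> < \<delta>\<close> L(2)
          by (intro \<delta>[rule_format, where T = ?K]) (use div in auto)
        then show ?thesis by simp
      qed
      ultimately show ?thesis using L(4) by simp
    qed
  qed
  obtain n where n: "(b - a) / \<eta> \<le> real n" using real_arch_simple by blast
  have "b \<le> a + real n * \<eta>" using n \<open>0 < \<eta>\<close> by (simp add: field_simps)
  with *[of _ n] show ?thesis by (intro exI[of _ "real n"]) force
qed

section \<open>Total variation and the Jordan decomposition\<close>

definition total_variation :: "(real \<Rightarrow> real) \<Rightarrow> real \<Rightarrow> real \<Rightarrow> real" where
  "total_variation g a x = (SUP L\<in>{L. sorted L \<and> set L \<subseteq> {a..x}}. list_variation g L)"

context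
  fixes g :: "real \<Rightarrow> real" and a b :: real
  assumes ac: "abs_continuous_on {a..b} g"
begin

lemma total_variation_upper:
  assumes "x \<le> b" "sorted L" "set L \<subseteq> {a..x}"
  shows "list_variation g L \<le> total_variation g a x"
proof -
  obtain M where M: "\<And>L. sorted L \<Longrightarrow> set L \<subseteq> {a..b} \<Longrightarrow> list_variation g L \<le> M"
    using bounded_list_variation[OF ac] by blast
  have "list_variation g L' \<le> M" if "sorted L'" "set L' \<subseteq> {a..x}" for L'
    using M[of L'] that assms(1) by force
  then have "bdd_above (list_variation g ` {L. sorted L \<and> set L \<subseteq> {a..x}})"
    by (intro bdd_aboveI2[of _ _ M]) auto
  then show ?thesis unfolding total_variation_def by (rule cSUP_upper2) (use assms in auto)
qed

text \<open>A list in \<open>{a..x}\<close> can be prolonged by \<open>x\<close> and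
  \<open>y\<close>. The inequality makes both the total variation and its difference with
  \<open>g\<close> nondecreasing.\<close>

lemma total_variation_increment_ge:
  assumes "a \<le> x" "x \<le> y" "y \<le> b"
  shows "total_variation g a x + \<bar>g y - g x\<bar> \<le> total_variation g a y"
proof -
  have "total_variation g a x \<le> total_variation g a y - \<bar>g y - g x\<bar>"
    unfolding total_variation_def[of g a x]
  proof (rule cSUP_least)
    have "[] \<in> {L. sorted L \<and> set L \<subseteq> {a..x}}" by simp
    then show "{L. sorted L \<and> set L \<subseteq> {a..x}} \<noteq> {}" by blast
    fix L assume L: "L \<in> {L. sorted L \<and> set L \<subseteq> {a..x}}"
    have "list_variation g L \<le> list_variation g (L @ [x])"
      using list_variation_insert[of g L "[]" x] by simp
    moreover have "list_variation g (L @ x # [y]) \<le> total_variation g a y"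
      using L assms by (intro total_variation_upper) (auto simp: sorted_append)
    ultimately show "list_variation g L \<le> total_variation g a y - \<bar>g y - g x\<bar>"
      using list_variation_append[of g L x "[y]"] by simp
  qed
  then show ?thesis by simp
qed

text \<open>A nearly optimal list in \<open>{a..y}\<close> is cut at \<open>x\<close>. Its left part
  is worth at most the total variation up to \<open>x\<close>, so the right part nearly attains the
  increment.\<close>

lemma total_variation_increment_le:
  assumes "a \<le> x" "x \<le> y" "y \<le> b" "0 < \<eta>"
  obtains L where "sorted L" "set L \<subseteq> {x..y}"
    "total_variation g a y - total_variation g a x \<le> list_variation g L + \<eta>"
proof -
  have "\<exists>L\<in>{L. sorted L \<and> set L \<subseteq> {a..y}}. total_variation g a y - \<eta> < list_variation g L"
  proof (rule ccontr)
    assume "\<not> ?thesis"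
    moreover have "[] \<in> {L. sorted L \<and> set L \<subseteq> {a..y}}" by simp
    ultimately have "total_variation g a y \<le> total_variation g a y - \<eta>"
      unfolding total_variation_def[of g a y] by (intro cSUP_least) (blast, force)
    with assms show False by simp
  qed
  then obtain L where L: "sorted L" "set L \<subseteq> {a..y}" "total_variation g a y - \<eta> < list_variation g L"
    by blast
  obtain xs ys where s: "sorted (xs @ [x])" "sorted (x # ys)" "set xs \<union> set ys = set L"
    "list_variation g L \<le> list_variation g (xs @ [x]) + list_variation g (x # ys)"
    using list_variation_split[OF L(1), of x g] by metis
  have "list_variation g (xs @ [x]) \<le> total_variation g a x"
    using assms s(1,3) L(2) by (intro total_variation_upper) (auto simp: sorted_append)
  moreover have "set (x # ys) \<subseteq> {x..y}" using s(2,3) L(2) assms by auto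
  ultimately show ?thesis using that[of "x # ys"] s L(3) by auto
qed

text \<open>In each interval of the division a list is chosen that nearly attains the increment of
  the total variation; absolute continuity of \<open>g\<close> bounds all these lists
  together.\<close>

lemma total_variation_abs_continuous: "abs_continuous_on {a..b} (total_variation g a)"
  unfolding abs_continuous_on_def
proof (intro allI impI)
  fix \<epsilon> :: real assume "0 < \<epsilon>"
  let ?V = "total_variation g a"
  obtain \<delta> where "0 < \<delta>" and \<delta>: "\<forall>D T L. D division_of T \<and> T \<subseteq> {a..b} \<and>
    (\<Sum>K\<in>D. Sup K - Inf K) < \<delta> \<and> (\<forall>K\<in>D. sorted (L K) \<and> set (L K) \<subseteq> K) \<longrightarrow>
    (\<Sum>K\<in>D. list_variation g (L K)) < \<epsilon> / 2"
    using abs_continuous_on_list_variation[OF ac half_gt_zero[OF \<open>0 < \<epsilon>\<close>]] by blast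
  have "(\<Sum>K\<in>D. norm (?V (Sup K) - ?V (Inf K))) < \<epsilon>"
    if D: "D division_of T" "T \<subseteq> {a..b}" "(\<Sum>K\<in>D. Sup K - Inf K) < \<delta>" for D T
  proof -
    \<comment> \<open>The \<open>card D\<close> errors of size \<eta> add up to at most half of
      \<epsilon>; the summand 1 keeps the divisor positive if \<open>D\<close> is empty.\<close>
    define \<eta> where "\<eta> = \<epsilon> / (2 * real (card D + 1))"
    have "0 < \<eta>" using \<open>0 < \<epsilon>\<close> by (simp add: \<eta>_def)
    have "\<exists>L. sorted L \<and> set L \<subseteq> K \<and> norm (?V (Sup K) - ?V (Inf K)) \<le> list_variation g L + \<eta>"
      if K: "K \<in> D" for K
    proof -
      obtain x y where xy: "K = {x..y}" "x \<le> y"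
        using division_ofD(3,4)[OF D(1) K] by (metis box_real(2) atLeastatMost_empty_iff2)
      then have "x \<in> K" "y \<in> K" by auto
      then have "x \<in> {a..b}" "y \<in> {a..b}" using division_ofD(2)[OF D(1) K] D(2) by blast+
      then have "a \<le> x" "y \<le> b" by auto
      then obtain L where "sorted L" "set L \<subseteq> {x..y}" "?V y - ?V x \<le> list_variation g L + \<eta>"
        using total_variation_increment_le \<open>x \<le> y\<close> \<open>0 < \<eta>\<close> by metis
      moreover have "?V x \<le> ?V y"
        using total_variation_increment_ge[OF \<open>a \<le> x\<close> \<open>x \<le> y\<close> \<open>y \<le> b\<close>] by linarith
      ultimately show ?thesis using xy by (intro exI[of _ L]) auto
    qed
    then obtain L where L: "\<And>K. K \<in> D \<Longrightarrow> sorted (L K) \<and> set (L K) \<subseteq> K"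
      and le: "\<And>K. K \<in> D \<Longrightarrow> norm (?V (Sup K) - ?V (Inf K)) \<le> list_variation g (L K) + \<eta>"
      by metis
    have "(\<Sum>K\<in>D. norm (?V (Sup K) - ?V (Inf K))) \<le> (\<Sum>K\<in>D. list_variation g (L K)) + card D * \<eta>"
      using sum_mono[OF le] by (simp add: sum.distrib)
    also have "card D * \<eta> \<le> \<epsilon> / 2"
      using \<open>0 < \<epsilon>\<close> by (simp add: \<eta>_def field_simps)
    also have "(\<Sum>K\<in>D. list_variation g (L K)) < \<epsilon> / 2"
      using \<delta>[rule_format, of D T L] D L by blast
    finally show ?thesis by simp
  qed
  with \<open>0 < \<delta>\<close> show "\<exists>\<delta>>0. \<forall>D T. D division_of T \<and> T \<subseteq> {a..b} \<and> (\<Sum>K\<in>D. Sup K - Inf K) < \<delta> \<longrightarrow>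
      (\<Sum>K\<in>D. norm (?V (Sup K) - ?V (Inf K))) < \<epsilon>"
    by blast
qed

end

lemma abs_continuous_on_diff:
  fixes f g :: "real \<Rightarrow> 'a::real_normed_vector"
  assumes "abs_continuous_on S f" "abs_continuous_on S g"
  shows "abs_continuous_on S (\<lambda>x. f x - g x)"
  unfolding abs_continuous_on_def
proof (intro allI impI)
  fix \<epsilon> :: real assume "0 < \<epsilon>"
  then have "0 < \<epsilon> / 2" by simp
  obtain \<delta> where \<delta>: "0 < \<delta>" "\<forall>D T. D division_of T \<and> T \<subseteq> S \<and> (\<Sum>K\<in>D. Sup K - Inf K) < \<delta> \<longrightarrow>
      (\<Sum>K\<in>D. norm (f (Sup K) - f (Inf K))) < \<epsilon> / 2"
    using assms(1)[unfolded abs_continuous_on_def, rule_format, OF \<open>0 < \<epsilon> / 2\<close>] by blast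
  obtain \<delta>' where \<delta>': "0 < \<delta>'" "\<forall>D T. D division_of T \<and> T \<subseteq> S \<and> (\<Sum>K\<in>D. Sup K - Inf K) < \<delta>' \<longrightarrow>
      (\<Sum>K\<in>D. norm (g (Sup K) - g (Inf K))) < \<epsilon> / 2"
    using assms(2)[unfolded abs_continuous_on_def, rule_format, OF \<open>0 < \<epsilon> / 2\<close>] by blast
  have "(\<Sum>K\<in>D. norm (f (Sup K) - g (Sup K) - (f (Inf K) - g (Inf K)))) < \<epsilon>"
    if "D division_of T" "T \<subseteq> S" "(\<Sum>K\<in>D. Sup K - Inf K) < min \<delta> \<delta>'" for D T
  proof -
    have "(\<Sum>K\<in>D. norm (f (Sup K) - g (Sup K) - (f (Inf K) - g (Inf K)))) \<le>
      (\<Sum>K\<in>D. norm (f (Sup K) - f (Inf K)) + norm (g (Sup K) - g (Inf K)))"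
    proof (intro sum_mono)
      fix K
      have "f (Sup K) - g (Sup K) - (f (Inf K) - g (Inf K)) = f (Sup K) - f (Inf K) - (g (Sup K) - g (Inf K))"
        by (simp add: algebra_simps)
      then show "norm (f (Sup K) - g (Sup K) - (f (Inf K) - g (Inf K))) \<le>
          norm (f (Sup K) - f (Inf K)) + norm (g (Sup K) - g (Inf K))"
        by (simp only: norm_triangle_ineq4)
    qed
    also have "\<dots> < \<epsilon>" using \<delta>(2)[rule_format, of D T] \<delta>'(2)[rule_format, of D T] that by (simp add: sum.distrib)
    finally show ?thesis .
  qed
  with \<delta>(1) \<delta>'(1) show "\<exists>\<delta>>0. \<forall>D T. D division_of T \<and> T \<subseteq> S \<and> (\<Sum>K\<in>D. Sup K - Inf K) < \<delta> \<longrightarrow>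
      (\<Sum>K\<in>D. norm (f (Sup K) - g (Sup K) - (f (Inf K) - g (Inf K)))) < \<epsilon>"
    by (intro exI[of _ "min \<delta> \<delta>'"]) auto
qed

text \<open>The Jordan decomposition into the total variation and its difference with
  \<open>g\<close>.\<close>

lemma abs_continuous_mono_decomposition:
  fixes g :: "real \<Rightarrow> real"
  assumes "abs_continuous_on {a..b} g"
  obtains F1 F2 where "abs_continuous_on {a..b} F1" "mono_on {a..b} F1"
    "abs_continuous_on {a..b} F2" "mono_on {a..b} F2" "\<And>x. g x = F1 x - F2 x"
proof
  note tv = total_variation_increment_ge[OF assms]
  show "abs_continuous_on {a..b} (total_variation g a)"
    by (rule total_variation_abs_continuous[OF assms])
  then show "abs_continuous_on {a..b} (\<lambda>x. total_variation g a x - g x)"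
    using assms by (rule abs_continuous_on_diff)
  show "mono_on {a..b} (total_variation g a)" "mono_on {a..b} (\<lambda>x. total_variation g a x - g x)"
    by (rule mono_onI, use tv in \<open>smt (verit) atLeastAtMost_iff\<close>)+
qed auto

lemma abs_continuous_on_imp_continuous:
  fixes F :: "real \<Rightarrow> 'a::real_normed_vector"
  assumes "abs_continuous_on {a..b} F"
  shows "continuous_on {a..b} F"
  unfolding continuous_on_iff
proof (intro ballI allI impI)
  fix x \<epsilon> :: real assume x: "x \<in> {a..b}" and "0 < \<epsilon>"
  obtain \<delta> where "0 < \<delta>" and \<delta>: "\<forall>D T. D division_of T \<and> T \<subseteq> {a..b} \<and>
      (\<Sum>K\<in>D. Sup K - Inf K) < \<delta> \<longrightarrow> (\<Sum>K\<in>D. norm (F (Sup K) - F (Inf K))) < \<epsilon>"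
    using assms[unfolded abs_continuous_on_def, rule_format, OF \<open>0 < \<epsilon>\<close>] by blast
  have "dist (F y) (F x) < \<epsilon>" if y: "y \<in> {a..b}" "dist y x < \<delta>" for y
  proof -
    let ?K = "{min x y..max x y}"
    have "{?K} division_of ?K"
      by (metis atLeastatMost_empty_iff2 box_real(2) division_of_self min_le_iff_disj max.cobounded1 order_refl)
    moreover have "?K \<subseteq> {a..b}" using x y by auto
    moreover have "(\<Sum>K\<in>{?K}. Sup K - Inf K) < \<delta>" using y by (auto simp: dist_real_def min_def max_def)
    ultimately have "(\<Sum>K\<in>{?K}. norm (F (Sup K) - F (Inf K))) < \<epsilon>" using \<delta> by blast
    then show ?thesis by (auto simp: dist_norm min_def max_def norm_minus_commute split: if_splits)
  qed
  with \<open>0 < \<delta>\<close> show "\<exists>\<delta>>0. \<forall>y\<in>{a..b}. dist y x < \<delta> \<longrightarrow> dist (F y) (F x) < \<epsilon>" by blast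
qed

section \<open>Primitives and densities\<close>

lemma negligible_uminus_image:
  fixes N :: "real set"
  shows "negligible N \<Longrightarrow> negligible (uminus ` N)"
  by (rule negligible_differentiable_image_negligible)
    (auto intro!: derivative_intros simp: differentiable_on_def)

text \<open>The library provides the one-sided derivative; the other side follows by reflection.\<close>

lemma indefinite_integral_has_derivative_ae:
  fixes \<phi> F :: "real \<Rightarrow> real"
  assumes int: "\<And>x y. x \<le> y \<Longrightarrow> (\<phi> has_integral F y - F x) {x..y}"
  obtains N where "negligible N" "\<And>x. x \<notin> N \<Longrightarrow> (F has_vector_derivative \<phi> x) (at x)"
proof -
  define I where "I x y = integral {x..y} \<phi>" for x y
  have I: "I x y = F y - F x" if "x \<le> y" for x y
    unfolding I_def using int[OF that] by (rule integral_unique)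
  have int': "\<phi> integrable_on {x..y}" for x y
  proof (cases "x \<le> y")
    case True
    then show ?thesis using int by (blast intro: has_integral_integrable)
  next
    case False
    then show ?thesis by (simp add: integrable_on_empty)
  qed
  have "\<phi> integrable_on cbox x y" for x y using int' by simp
  then obtain N1 where N1: "negligible N1"
    "\<And>x e. \<lbrakk>x \<notin> N1; 0 < e\<rbrakk> \<Longrightarrow> \<exists>d>0. \<forall>h. 0 < h \<and> h < d \<longrightarrow>
       norm (integral (cbox x (x + h *\<^sub>R One)) \<phi> /\<^sub>R h ^ DIM(real) - \<phi> x) < e"
    using integrable_ccontinuous_explicit[of \<phi>] by blast
  have "(\<lambda>x. \<phi> (- x)) integrable_on cbox x y" for x y
    using int'[of "- y" "- x"] Henstock_Kurzweil_Integration.integrable_reflect_real[of \<phi> "- x" "- y"] by simp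
  then obtain N2 where N2: "negligible N2"
    "\<And>x e. \<lbrakk>x \<notin> N2; 0 < e\<rbrakk> \<Longrightarrow> \<exists>d>0. \<forall>h. 0 < h \<and> h < d \<longrightarrow>
       norm (integral (cbox x (x + h *\<^sub>R One)) (\<lambda>x. \<phi> (- x)) /\<^sub>R h ^ DIM(real) - \<phi> (- x)) < e"
    using integrable_ccontinuous_explicit[of "\<lambda>x. \<phi> (- x)"] by blast
  show ?thesis
  proof (rule that)
    show "negligible (N1 \<union> uminus ` N2)" using N1(1) N2(1) by (intro negligible_Un negligible_uminus_image)
    fix x assume "x \<notin> N1 \<union> uminus ` N2"
    then have x: "x \<notin> N1" "- x \<notin> N2" by (auto simp: image_iff)
    show "(F has_vector_derivative \<phi> x) (at x)"
      unfolding has_vector_derivative_def has_derivative_at_alt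
    proof (intro conjI allI impI)
      show "bounded_linear (\<lambda>h. h *\<^sub>R \<phi> x)" by (rule bounded_linear_scaleR_left)
      fix e :: real assume "0 < e"
      obtain d1 where d1: "d1 > 0" "\<And>h. 0 < h \<and> h < d1 \<Longrightarrow> \<bar>I x (x + h) / h - \<phi> x\<bar> < e"
        using N1(2)[OF x(1) \<open>0 < e\<close>] by (auto simp: I_def divide_inverse mult.commute)
      have r: "integral {- x..- x + h} (\<lambda>x. \<phi> (- x)) = I (x - h) x" for h
        using Henstock_Kurzweil_Integration.integral_reflect_real[of x "x - h" \<phi>] by (simp add: I_def)
      obtain d2 where d2: "d2 > 0" "\<And>h. 0 < h \<and> h < d2 \<Longrightarrow> \<bar>I (x - h) x / h - \<phi> x\<bar> < e"
        using N2(2)[OF x(2) \<open>0 < e\<close>] r by (auto simp: divide_inverse mult.commute)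
      show "\<exists>d>0. \<forall>y. norm (y - x) < d \<longrightarrow> norm (F y - F x - (y - x) *\<^sub>R \<phi> x) \<le> e * norm (y - x)"
      proof (intro exI[of _ "min d1 d2"] conjI allI impI)
        fix y assume y: "norm (y - x) < min d1 d2"
        consider "y = x" | "x < y" | "y < x" by linarith
        then show "norm (F y - F x - (y - x) *\<^sub>R \<phi> x) \<le> e * norm (y - x)"
        proof cases
          case 2
          then have "\<bar>(F y - F x) / (y - x) - \<phi> x\<bar> < e" using d1(2)[of "y - x"] y I[of x y] by simp
          moreover have "F y - F x - (y - x) *\<^sub>R \<phi> x = ((F y - F x) / (y - x) - \<phi> x) * (y - x)"
            using 2 by (simp add: field_simps)
          ultimately show ?thesis using 2 by (simp add: abs_mult mult_right_mono)
        next
          case 3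
          then have "\<bar>(F x - F y) / (x - y) - \<phi> x\<bar> < e" using d2(2)[of "x - y"] y I[of y x] by simp
          moreover have "F y - F x - (y - x) *\<^sub>R \<phi> x = ((F x - F y) / (x - y) - \<phi> x) * (y - x)"
            using 3 by (simp add: field_simps)
          ultimately show ?thesis using 3 by (simp add: abs_mult mult_right_mono)
        qed simp
      qed (use d1 d2 in auto)
    qed
  qed
qed

text \<open>The intervals may share endpoints, but their interiors are disjoint and have the same
  lengths.\<close>

lemma sum_lengths_le_emeasure:
  assumes "D division_of T" "T \<subseteq> U" "U \<in> sets borel"
  shows "ennreal (\<Sum>K\<in>D. Sup K - Inf K) \<le> emeasure lborel U"
proof -
  have fin: "finite D" using assms(1) by auto
  have conv: "\<exists>x y. K = {x..y} \<and> x \<le> y" if "K \<in> D" for K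
    using assms(1) that by (metis box_real(2) division_ofD(3,4) atLeastatMost_empty_iff2)
  have "ennreal (\<Sum>K\<in>D. Sup K - Inf K) = (\<Sum>K\<in>D. ennreal (Sup K - Inf K))"
    by (subst sum_ennreal) (use conv in fastforce)+
  also have "\<dots> = (\<Sum>K\<in>D. emeasure lborel (interior K))"
    by (intro sum.cong refl) (use conv in fastforce)
  also have "\<dots> = emeasure lborel (\<Union>K\<in>D. interior K)"
    by (rule sum_emeasure)
      (use fin division_ofD(5)[OF assms(1)] in \<open>auto simp: disjoint_family_on_def\<close>)
  also have "\<dots> \<le> emeasure lborel U"
    using assms division_ofD(2)[OF assms(1)] interior_subset by (intro emeasure_mono) fastforce+
  finally show ?thesis .
qed

text \<open>One \<phi> has two roles: it recovers \<open>g\<close> by gauge integration, and off a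
  null set it is the derivative of \<open>g\<close>. Together they allow an equation for the
  derivative to be carried under the integral.\<close>

definition lebesgue_primitive ::
  "real \<Rightarrow> real \<Rightarrow> (real \<Rightarrow> 'a::real_normed_vector) \<Rightarrow> (real \<Rightarrow> 'a) \<Rightarrow> bool" where
  "lebesgue_primitive a b g \<phi> \<longleftrightarrow>
    (\<forall>x y. a \<le> x \<and> x \<le> y \<and> y \<le> b \<longrightarrow> (\<phi> has_integral g y - g x) {x..y}) \<and>
    (\<exists>N. negligible N \<and> (\<forall>x\<in>{a..b} - N. (g has_vector_derivative \<phi> x) (at x within {a..b})))"

text \<open>The Stieltjes measure of a Lebesgue null set \<open>B\<close> vanishes: \<open>B\<close>
  lies in an open set of measure below \<delta>, any compact subset is covered by finitely many
  intervals inside that set, and the increments of \<open>F\<close> over them add up to less than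
  \<epsilon>. Inner regularity passes from compact subsets to \<open>B\<close>, and Radon-Nikodym
  yields the density.\<close>

lemma mono_abs_continuous_density:
  fixes F :: "real \<Rightarrow> real"
  assumes ac: "abs_continuous_on {a..b} F" and mono: "mono_on {a..b} F" and "a \<le> b"
  shows "\<exists>\<phi>. lebesgue_primitive a b F \<phi>"
proof -
  \<comment> \<open>\<open>interval_measure\<close> takes a function on the whole line;
    \<open>F\<close> is continued by constants, so nothing is charged outside of
    \<open>{a..b}\<close>.\<close>
  define clamp where "clamp x = max a (min b x)" for x
  define G where "G x = F (clamp x)" for x
  have clamp: "clamp x \<in> {a..b}" "x \<in> {a..b} \<Longrightarrow> clamp x = x" for x
    using \<open>a \<le> b\<close> by (auto simp: clamp_def)
  have monoG: "G x \<le> G y" if "x \<le> y" for x y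
    unfolding G_def by (rule mono_onD[OF mono]) (use clamp that in \<open>auto simp: clamp_def\<close>)
  have contG: "continuous_on UNIV G"
    unfolding G_def
    by (rule continuous_on_compose2[OF abs_continuous_on_imp_continuous[OF ac]])
      (use clamp in \<open>auto simp: clamp_def intro!: continuous_intros\<close>)
  define M where "M = interval_measure G"
  have sets_M [simp]: "sets M = sets borel" by (simp add: M_def)
  have space_M [simp]: "space M = UNIV" by (simp add: M_def)
  have "continuous (at_right x) G" for x
    using contG by (simp add: continuous_on_eq_continuous_at continuous_at_imp_continuous_at_within)
  then have Ioc: "emeasure M {x<..y} = ennreal (G y - G x)" if "x \<le> y" for x y
    unfolding M_def using that monoG by (intro emeasure_interval_measure_Ioc)
  have Icc: "emeasure M {x..y} = ennreal (G y - G x)" if "x \<le> y" for x y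
    unfolding M_def using that monoG contG by (intro emeasure_interval_measure_Icc)
  \<comment> \<open>Each half-line is a countable union of bounded intervals on which
    \<open>G\<close> has no increment.\<close>
  have "(\<Union>n. {a - real n<..a}) \<in> null_sets M"
    by (rule null_sets_UN) (auto simp: null_sets_def Ioc G_def clamp_def \<open>a \<le> b\<close>)
  moreover have "(\<Union>n. {b<..b + real n}) \<in> null_sets M"
    by (rule null_sets_UN) (auto simp: null_sets_def Ioc G_def clamp_def \<open>a \<le> b\<close>)
  ultimately have null: "(\<Union>n. {a - real n<..a}) \<union> (\<Union>n. {b<..b + real n}) \<in> null_sets M"
    by (rule null_sets.Un)
  have "- {a..b} \<subseteq> (\<Union>n. {a - real n<..a}) \<union> (\<Union>n. {b<..b + real n})"
  proof
    fix x assume x: "x \<in> - {a..b}"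
    obtain n where "max (a - x) (x - b) < real n" using reals_Archimedean2 by blast
    then have "x \<in> {a - real n<..a} \<or> x \<in> {b<..b + real n}" using x by auto
    then show "x \<in> (\<Union>n. {a - real n<..a}) \<union> (\<Union>n. {b<..b + real n})" by blast
  qed
  then have null': "- {a..b} \<in> null_sets M" using null by (rule null_sets_subset[rotated 2]) auto
  \<comment> \<open>It thus suffices to cover the part of a set inside \<open>{a..b}\<close>, the
    only place where absolute continuity of \<open>F\<close> gives information.\<close>
  have split: "emeasure M A \<le> emeasure M B" if "A \<subseteq> B \<union> - {a..b}" "B \<in> sets borel" for A B :: "real set"
  proof -
    have "emeasure M A \<le> emeasure M (B \<union> - {a..b})" using that by (intro emeasure_mono) auto
    also have "\<dots> = emeasure M B" using that null' by (intro emeasure_Un_null_set) auto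
    finally show ?thesis .
  qed
  have fin: "emeasure M (space M) \<noteq> \<infinity>"
    using split[of UNIV "{a..b}"] Icc[OF \<open>a \<le> b\<close>] by (auto simp: top_unique)
  have "absolutely_continuous lborel M"
    unfolding absolutely_continuous_def
  proof
    fix B :: "real set" assume "B \<in> null_sets lborel"
    then have B: "B \<in> sets borel" "emeasure lborel B = 0" by auto
    have "emeasure M B \<le> ennreal \<epsilon>" if "0 < \<epsilon>" for \<epsilon>
    proof -
      obtain \<delta> where "0 < \<delta>" and \<delta>: "\<forall>D T. D division_of T \<and> T \<subseteq> {a..b} \<and>
          (\<Sum>K\<in>D. Sup K - Inf K) < \<delta> \<longrightarrow> (\<Sum>K\<in>D. norm (F (Sup K) - F (Inf K))) < \<epsilon>"
        using ac[unfolded abs_continuous_on_def, rule_format, OF \<open>0 < \<epsilon>\<close>] by blast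
      obtain U where U: "open U" "B \<subseteq> U" "emeasure lborel (U - B) < \<delta>"
        using outer_regular_lborel[OF B(1) \<open>0 < \<delta>\<close>] by blast
      have "emeasure lborel U < \<delta>"
        using U emeasure_Diff_null_set[of B lborel U] B by (auto simp: null_sets_def)
      have "emeasure M K \<le> ennreal \<epsilon>" if K: "K \<subseteq> B" "compact K" for K
      proof -
        have "\<exists>r>0. cball x r \<subseteq> U" if "x \<in> K" for x
          using that K(1) U by (meson open_contains_cball subset_iff)
        then obtain r where r: "\<And>x. x \<in> K \<Longrightarrow> r x > 0 \<and> cball x (r x) \<subseteq> U" by metis
        have "K \<subseteq> (\<Union>x\<in>K. ball x (r x))" using r by force
        then obtain C where C: "C \<subseteq> K" "finite C" "K \<subseteq> (\<Union>x\<in>C. ball x (r x))"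
          using compactE_image[OF K(2), of K "\<lambda>x. ball x (r x)"] by auto
        \<comment> \<open>The intervals are cut off at \<open>a\<close> and \<open>b\<close> to stay
          within reach of the hypothesis on \<open>F\<close>. They may overlap, so their union is
          divided anew by \<open>D\<close>.\<close>
        define \<F> where "\<F> = (\<lambda>x. {max a (x - r x)..min b (x + r x)}) ` C"
        obtain D where D: "D division_of \<Union>\<F>"
        proof (rule elementary_unions_intervals[of \<F>])
          show "finite \<F>" using C by (simp add: \<F>_def)
          show "\<exists>a b. s = cbox a b" if "s \<in> \<F>" for s using that by (auto simp: \<F>_def)
        qed
        have "\<Union>\<F> \<subseteq> U"
        proof -
          have "{max a (x - r x)..min b (x + r x)} \<subseteq> U" if "x \<in> C" for x
            using r[of x] that C(1) by (auto simp: cball_eq_atLeastAtMost subset_iff)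
          then show ?thesis by (auto simp: \<F>_def)
        qed
        then have "ennreal (\<Sum>K\<in>D. Sup K - Inf K) < ennreal \<delta>"
          using sum_lengths_le_emeasure[OF D _ borel_open[OF U(1)]] \<open>emeasure lborel U < \<delta>\<close>
          by (meson le_less_trans)
        then have "(\<Sum>K\<in>D. Sup K - Inf K) < \<delta>"
          using ennreal_leI[of \<delta> "\<Sum>K\<in>D. Sup K - Inf K"] by (meson leD leI)
        moreover have sub: "\<Union>\<F> \<subseteq> {a..b}" by (auto simp: \<F>_def)
        ultimately have small: "(\<Sum>K\<in>D. norm (F (Sup K) - F (Inf K))) < \<epsilon>" using \<delta> D by blast
        have ms: "E \<in> sets M" if "E \<in> D" for E
          using division_ofD(4)[OF D that] by auto
        have "K \<subseteq> \<Union>D \<union> - {a..b}"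
        proof
          fix x assume "x \<in> K"
          then obtain z where z: "z \<in> C" "x \<in> ball z (r z)" using C by blast
          show "x \<in> \<Union>D \<union> - {a..b}"
          proof (cases "x \<in> {a..b}")
            case True
            with z have "x \<in> \<Union>\<F>" by (auto simp: \<F>_def dist_real_def intro!: bexI[of _ z])
            then show ?thesis using division_ofD(6)[OF D] by simp
          qed auto
        qed
        then have "emeasure M K \<le> emeasure M (\<Union>D)"
          by (rule split) (use D ms in auto)
        also have "\<dots> \<le> (\<Sum>E\<in>D. emeasure M E)"
          using emeasure_subadditive_finite[of D "\<lambda>x. x" M] D ms by auto
        also have "\<dots> \<le> (\<Sum>E\<in>D. ennreal (norm (F (Sup E) - F (Inf E))))"
        proof (rule sum_mono)
          fix E assume E: "E \<in> D"
          obtain x y where xy: "E = {x..y}" "x \<le> y"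
            using division_ofD(3,4)[OF D E] by (metis box_real(2) atLeastatMost_empty_iff2)
          then have "x \<in> E" "y \<in> E" by auto
          then have "x \<in> {a..b}" "y \<in> {a..b}"
            using division_ofD(2)[OF D E] sub by blast+
          then show "emeasure M E \<le> ennreal (norm (F (Sup E) - F (Inf E)))"
            using xy by (simp add: Icc G_def clamp(2) ennreal_leI)
        qed
        also have "\<dots> = ennreal (\<Sum>E\<in>D. norm (F (Sup E) - F (Inf E)))" by simp
        also have "\<dots> \<le> ennreal \<epsilon>" using small by (intro ennreal_leI) simp
        finally show ?thesis .
      qed
      then show ?thesis
        by (subst inner_regular[OF sets_M fin B(1)]) (auto intro!: SUP_least)
    qed
    then have "emeasure M B = 0"
      by (metis ennreal_le_epsilon add_0 zero_less_one le_zero_eq)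
    then show "B \<in> null_sets M" using B(1) by (simp add: null_sets_def)
  qed
  then obtain f where f: "f \<in> borel_measurable lborel" "density lborel f = M"
    using sigma_finite_measure.Radon_Nikodym[of lborel M] sigma_finite_lborel by auto
  \<comment> \<open>Where \<open>f\<close> is infinite the value becomes 0; this concerns only a
    null set, since \<open>M\<close> is finite.\<close>
  define \<phi> where "\<phi> x = enn2real (f x)" for x
  have [measurable]: "f \<in> borel_measurable borel"
    using f(1) by simp
  have [measurable]: "\<phi> \<in> borel_measurable borel"
    unfolding \<phi>_def[abs_def] by measurable
  have "(\<integral>\<^sup>+x. f x \<partial>lborel) = emeasure M UNIV"
    by (subst f(2)[symmetric]) (simp add: emeasure_density)
  then have "AE x in lborel. f x \<noteq> \<infinity>"
    using fin f(1) by (intro nn_integral_PInf_AE) auto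
  then have fin_ae: "AE x in lborel. ennreal (\<phi> x) = f x"
    by eventually_elim (auto simp: \<phi>_def top.not_eq_extremum)
  have int: "(\<phi> has_integral G y - G x) {x..y}" if "x \<le> y" for x y
  proof -
    have "(\<integral>\<^sup>+z. ennreal (\<phi> z * indicator {x..y} z) \<partial>lborel) = (\<integral>\<^sup>+z. f z * indicator {x..y} z \<partial>lborel)"
      by (rule nn_integral_cong_AE) (use fin_ae in eventually_elim, auto simp: indicator_def)
    also have "\<dots> = emeasure M {x..y}"
      by (subst f(2)[symmetric]) (simp add: emeasure_density)
    finally have "((\<lambda>z. \<phi> z * indicator {x..y} z) has_integral G y - G x) UNIV"
      using monoG[OF that] Icc[OF that] by (intro nn_integral_has_integral) (auto simp: \<phi>_def)
    moreover have "(\<lambda>z. \<phi> z * indicator {x..y} z) = (\<lambda>z. if z \<in> {x..y} then \<phi> z else 0)"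
      by (auto simp: indicator_def)
    ultimately show ?thesis using has_integral_restrict_UNIV[of "{x..y}" \<phi>] by simp
  qed
  obtain N where N: "negligible N" "\<And>x. x \<notin> N \<Longrightarrow> (G has_vector_derivative \<phi> x) (at x)"
    using indefinite_integral_has_derivative_ae[OF int] by blast
  show ?thesis
    unfolding lebesgue_primitive_def
  proof (intro exI conjI allI impI ballI)
    show "(\<phi> has_integral F y - F x) {x..y}" if "a \<le> x \<and> x \<le> y \<and> y \<le> b" for x y
      using int[of x y] that by (simp add: G_def clamp(2))
    show "negligible N" by (rule N(1))
    show "(F has_vector_derivative \<phi> x) (at x within {a..b})" if "x \<in> {a..b} - N" for x
    proof -
      have x: "x \<in> {a..b}" and "(G has_vector_derivative \<phi> x) (at x within {a..b})"
        using that N(2)[of x] by (auto intro: has_vector_derivative_at_within)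
      moreover have "F y = G y" if "y \<in> {a..b}" for y using that by (simp add: G_def clamp(2))
      ultimately show ?thesis by (metis has_vector_derivative_transform)
    qed
  qed
qed

lemma abs_continuous_density_real:
  fixes g :: "real \<Rightarrow> real"
  assumes "abs_continuous_on {a..b} g" "a \<le> b"
  shows "\<exists>\<phi>. lebesgue_primitive a b g \<phi>"
proof -
  obtain F1 F2 where F: "abs_continuous_on {a..b} F1" "mono_on {a..b} F1"
    "abs_continuous_on {a..b} F2" "mono_on {a..b} F2" and g: "\<And>x. g x = F1 x - F2 x"
    using abs_continuous_mono_decomposition[OF assms(1)] by blast
  obtain \<phi>1 \<phi>2 where prim: "lebesgue_primitive a b F1 \<phi>1" "lebesgue_primitive a b F2 \<phi>2"
    using mono_abs_continuous_density F assms(2) by meson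
  then obtain N1 N2 where N: "negligible N1" "negligible N2"
    and d: "\<forall>x\<in>{a..b} - N1. (F1 has_vector_derivative \<phi>1 x) (at x within {a..b})"
      "\<forall>x\<in>{a..b} - N2. (F2 has_vector_derivative \<phi>2 x) (at x within {a..b})"
    unfolding lebesgue_primitive_def by blast
  have g': "g = (\<lambda>x. F1 x - F2 x)" using g by auto
  show ?thesis
    unfolding lebesgue_primitive_def
  proof (intro exI conjI allI impI ballI)
    show "negligible (N1 \<union> N2)" using N by (rule negligible_Un)
    show "((\<lambda>x. \<phi>1 x - \<phi>2 x) has_integral g y - g x) {x..y}" if "a \<le> x \<and> x \<le> y \<and> y \<le> b" for x y
    proof -
      have "(\<phi>1 has_integral F1 y - F1 x) {x..y}" "(\<phi>2 has_integral F2 y - F2 x) {x..y}"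
        using prim that unfolding lebesgue_primitive_def by auto
      from has_integral_diff[OF this] show ?thesis by (simp add: g' algebra_simps)
    qed
    show "(g has_vector_derivative \<phi>1 x - \<phi>2 x) (at x within {a..b})" if "x \<in> {a..b} - (N1 \<union> N2)" for x
      unfolding g' using that d by (intro has_vector_derivative_diff) auto
  qed
qed

text \<open>Applied to the real and the imaginary part.\<close>

lemma abs_continuous_on_nonexpansive:
  fixes f :: "real \<Rightarrow> 'a::real_normed_vector"
  assumes "abs_continuous_on S f" "\<And>z w. norm (h z - h w) \<le> norm (z - w)"
  shows "abs_continuous_on S (\<lambda>x. h (f x))"
  unfolding abs_continuous_on_def
proof (intro allI impI)
  fix \<epsilon> :: real assume "0 < \<epsilon>"
  then obtain \<delta> where \<delta>: "0 < \<delta>" "\<forall>D T. D division_of T \<and> T \<subseteq> S \<and> (\<Sum>K\<in>D. Sup K - Inf K) < \<delta> \<longrightarrow>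
      (\<Sum>K\<in>D. norm (f (Sup K) - f (Inf K))) < \<epsilon>"
    using assms(1)[unfolded abs_continuous_on_def, rule_format, OF \<open>0 < \<epsilon>\<close>] by blast
  have "(\<Sum>K\<in>D. norm (h (f (Sup K)) - h (f (Inf K)))) \<le> (\<Sum>K\<in>D. norm (f (Sup K) - f (Inf K)))" for D :: "real set set"
    by (intro sum_mono assms(2))
  with \<delta> show "\<exists>\<delta>>0. \<forall>D T. D division_of T \<and> T \<subseteq> S \<and> (\<Sum>K\<in>D. Sup K - Inf K) < \<delta> \<longrightarrow>
      (\<Sum>K\<in>D. norm (h (f (Sup K)) - h (f (Inf K)))) < \<epsilon>"
    by (meson le_less_trans)
qed

lemma abs_continuous_density:
  fixes g :: "real \<Rightarrow> complex"
  assumes "abs_continuous_on {a..b} g" "a \<le> b"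
  shows "\<exists>\<phi>. lebesgue_primitive a b g \<phi>"
proof -
  have "abs_continuous_on {a..b} (\<lambda>x. Re (g x))" "abs_continuous_on {a..b} (\<lambda>x. Im (g x))"
    by (rule abs_continuous_on_nonexpansive[OF assms(1)],
      metis abs_Re_le_cmod minus_complex.sel(1) real_norm_def,
      rule abs_continuous_on_nonexpansive[OF assms(1)],
      metis abs_Im_le_cmod minus_complex.sel(2) real_norm_def)
  note ac = this
  obtain \<phi>1 \<phi>2 where prim: "lebesgue_primitive a b (\<lambda>x. Re (g x)) \<phi>1" "lebesgue_primitive a b (\<lambda>x. Im (g x)) \<phi>2"
    using abs_continuous_density_real ac assms(2) by meson
  then obtain N1 N2 where N: "negligible N1" "negligible N2"
    and d: "\<forall>x\<in>{a..b} - N1. ((\<lambda>x. Re (g x)) has_vector_derivative \<phi>1 x) (at x within {a..b})"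
      "\<forall>x\<in>{a..b} - N2. ((\<lambda>x. Im (g x)) has_vector_derivative \<phi>2 x) (at x within {a..b})"
    unfolding lebesgue_primitive_def by blast
  have g: "(\<lambda>x. complex_of_real (Re (g x)) + \<i> * complex_of_real (Im (g x))) = g"
    by (simp add: complex_eq[symmetric])
  let ?\<phi> = "\<lambda>x. complex_of_real (\<phi>1 x) + \<i> * complex_of_real (\<phi>2 x)"
  show ?thesis
    unfolding lebesgue_primitive_def
  proof (intro exI conjI allI impI ballI)
    show "negligible (N1 \<union> N2)" using N by (rule negligible_Un)
    show "(?\<phi> has_integral g y - g x) {x..y}" if "a \<le> x \<and> x \<le> y \<and> y \<le> b" for x y
    proof -
      have "(\<phi>1 has_integral Re (g y) - Re (g x)) {x..y}" "(\<phi>2 has_integral Im (g y) - Im (g x)) {x..y}"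
        using prim that unfolding lebesgue_primitive_def by auto
      from has_integral_add[OF has_integral_of_real[OF this(1), where 'b = complex]
          has_integral_mult_right[OF has_integral_of_real[OF this(2), where 'b = complex], of \<i>]]
      have "(?\<phi> has_integral complex_of_real (Re (g y) - Re (g x)) + \<i> * complex_of_real (Im (g y) - Im (g x))) {x..y}" .
      moreover have "complex_of_real (Re (g y) - Re (g x)) + \<i> * complex_of_real (Im (g y) - Im (g x)) = g y - g x"
        by (simp add: complex_eq_iff)
      ultimately show ?thesis by simp
    qed
    show "(g has_vector_derivative ?\<phi> x) (at x within {a..b})" if "x \<in> {a..b} - (N1 \<union> N2)" for x
    proof -
      have "((\<lambda>x. complex_of_real (Re (g x)) + \<i> * complex_of_real (Im (g x))) has_vector_derivative ?\<phi> x) (at x within {a..b})"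
        using that d by (intro has_vector_derivative_add has_vector_derivative_mult_right
            has_vector_derivative_of_real)
          (auto simp: has_real_derivative_iff_has_vector_derivative)
      then show ?thesis using g by simp
    qed
  qed
qed

text \<open>Where the derivative of an absolutely continuous function fails to exist,
  \<open>vector_derivative\<close> is an arbitrary constant, so an equation for it holding almost everywhere is
  informative only because these points form a null set.\<close>

lemma abs_continuous_antiderivative:
  fixes g :: "real \<Rightarrow> complex"
  assumes "abs_continuous_on {a..b} g" "a < b" "continuous_on {a..b} h"
    and ae: "AE x in lebesgue_on {a..b}. vector_derivative g (at x within {a..b}) = h x"
    and x: "x \<in> {a..b}"
  shows "(g has_vector_derivative h x) (at x within {a..b})"
proof -
  obtain \<phi> where "lebesgue_primitive a b g \<phi>"
    using abs_continuous_density[OF assms(1) less_imp_le[OF assms(2)]] by blast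
  then obtain N where N: "negligible N"
    and int: "\<forall>x y. a \<le> x \<and> x \<le> y \<and> y \<le> b \<longrightarrow> (\<phi> has_integral g y - g x) {x..y}"
    and d: "\<forall>x\<in>{a..b} - N. (g has_vector_derivative \<phi> x) (at x within {a..b})"
    unfolding lebesgue_primitive_def by blast
  have "AE x in lebesgue. x \<in> {a..b} \<longrightarrow> vector_derivative g (at x within {a..b}) = h x"
    using ae by (subst (asm) AE_restrict_space_iff) auto
  then obtain N' where "N' \<in> null_sets lebesgue"
    "{x. \<not> (x \<in> {a..b} \<longrightarrow> vector_derivative g (at x within {a..b}) = h x)} \<subseteq> N'"
    unfolding eventually_ae_filter by auto
  then have N': "negligible N'"
    "\<And>x. x \<in> {a..b} - N' \<Longrightarrow> vector_derivative g (at x within {a..b}) = h x"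
    by (auto simp: negligible_iff_null_sets)
  have eq: "\<phi> x = h x" if "x \<in> {a..b} - (N \<union> N')" for x
  proof -
    have "(g has_vector_derivative \<phi> x) (at x within {a..b})" "x \<in> {a..b}" using d that by auto
    then have "vector_derivative g (at x within {a..b}) = \<phi> x"
      using vector_derivative_within_closed_interval[OF assms(2)] by blast
    then show ?thesis using N'(2)[of x] that by simp
  qed
  \<comment> \<open>Since \<open>g\<close> is the integral of the continuous \<open>h\<close>, its
    derivative is \<open>h\<close> at every point and not just almost everywhere.\<close>
  have g: "g u = g a + integral {a..u} h" if "u \<in> {a..b}" for u
  proof -
    have "(h has_integral g u - g a) {a..u}"
    proof (rule has_integral_spike)
      show "negligible (N \<union> N')" using N N'(1) by (rule negligible_Un)
      show "(\<phi> has_integral g u - g a) {a..u}" using int that by auto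
      show "h x = \<phi> x" if "x \<in> {a..u} - (N \<union> N')" for x using eq[of x] that \<open>u \<in> {a..b}\<close> by auto
    qed
    then show ?thesis by (simp add: integral_unique)
  qed
  have "((\<lambda>u. g a + integral {a..u} h) has_vector_derivative h x) (at x within {a..b})"
    using has_vector_derivative_add[OF has_vector_derivative_const
        integral_has_vector_derivative[OF assms(3) x]] by simp
  then show ?thesis by (rule has_vector_derivative_transform[OF x g, rotated])
qed

section \<open>Eigenfunctions on a single edge\<close>

text \<open>The fundamental solutions of \<open>u'' = - t u\<close>; the complex square root covers both signs of \<open>t\<close>.\<close>

definition cos_sol :: "real \<Rightarrow> real \<Rightarrow> complex" where
  "cos_sol t x = cos (csqrt (complex_of_real t) * complex_of_real x)"

text \<open>At \<open>t = 0\<close> the quotient would be 0 by the convention for division;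
  \<open>x\<close> is its limit.\<close>

definition sin_sol :: "real \<Rightarrow> real \<Rightarrow> complex" where
  "sin_sol t x = (if t = 0 then complex_of_real x
     else sin (csqrt (complex_of_real t) * complex_of_real x) / csqrt (complex_of_real t))"

lemma csqrt_mult_self: "csqrt z * csqrt z = z"
  by (metis power2_csqrt power2_eq_square)

lemma cos_sol_0 [simp]: "cos_sol t 0 = 1" and sin_sol_0 [simp]: "sin_sol t 0 = 0"
  by (auto simp: cos_sol_def sin_sol_def)

lemma cos_sol_deriv: "(cos_sol t has_vector_derivative - complex_of_real t * sin_sol t x) (at x within S)"
proof -
  let ?w = "csqrt (complex_of_real t)"
  have "((\<lambda>x. cos (?w * complex_of_real x)) has_vector_derivative - sin (?w * complex_of_real x) * ?w) (at x within S)"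
    by (rule has_vector_derivative_real_field) (auto intro!: derivative_eq_intros)
  moreover have "- sin (?w * complex_of_real x) * ?w = - complex_of_real t * sin_sol t x"
    using csqrt_mult_self[of "complex_of_real t"] by (auto simp: sin_sol_def field_simps)
  ultimately show ?thesis by (simp add: cos_sol_def[abs_def])
qed

lemma sin_sol_deriv: "(sin_sol t has_vector_derivative cos_sol t x) (at x within S)"
proof -
  let ?w = "csqrt (complex_of_real t)"
  show ?thesis
  proof (cases "t = 0")
    case True
    then have "sin_sol t = complex_of_real" by (auto simp: sin_sol_def)
    moreover have "(complex_of_real has_vector_derivative 1) (at x within S)"
      using has_vector_derivative_of_real[OF DERIV_ident] by simp
    ultimately show ?thesis using True by (simp add: cos_sol_def)
  next
    case False
    have "((\<lambda>x. sin (?w * complex_of_real x) / ?w) has_vector_derivative cos (?w * complex_of_real x)) (at x within S)"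
      by (rule has_vector_derivative_real_field) (use False in \<open>auto intro!: derivative_eq_intros\<close>)
    with False show ?thesis by (simp add: sin_sol_def[abs_def] cos_sol_def)
  qed
qed

text \<open>The left side is the Wronskian of the two solutions.\<close>

lemma cos_sin_sol_identity: "cos_sol t x * cos_sol t x + t * (sin_sol t x * sin_sol t x) = 1"
proof -
  let ?w = "csqrt (complex_of_real t)"
  have "t * (sin_sol t x * sin_sol t x) = sin (?w * x) * sin (?w * x)"
    using csqrt_mult_self[of "complex_of_real t"] by (auto simp: sin_sol_def field_simps)
  then show ?thesis
    using sin_cos_squared_add[of "?w * complex_of_real x"] by (simp add: cos_sol_def power2_eq_square add.commute)
qed

lemma cos_sol_add: "cos_sol t (x + y) = cos_sol t x * cos_sol t y - t * (sin_sol t x * sin_sol t y)"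
proof -
  let ?w = "csqrt (complex_of_real t)"
  have "t * (sin_sol t x * sin_sol t y) = sin (?w * x) * sin (?w * y)"
    using csqrt_mult_self[of "complex_of_real t"] by (auto simp: sin_sol_def field_simps)
  then show ?thesis by (simp add: cos_sol_def distrib_left cos_add)
qed

lemma sin_sol_add: "sin_sol t (x + y) = sin_sol t x * cos_sol t y + cos_sol t x * sin_sol t y"
  by (auto simp: sin_sol_def cos_sol_def distrib_left sin_add add_divide_distrib)

text \<open>The combinations \<open>u * cos_sol - u' * sin_sol\<close> and
  \<open>t * u * sin_sol + u' * cos_sol\<close> have derivative 0, so they keep their initial values
  \<open>u 0\<close> and \<open>u' 0\<close>. Their determinant as a linear system for
  \<open>u x\<close> and \<open>u' x\<close> is the Wronskian 1.\<close>

lemma initial_value_problem: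
  assumes u: "\<And>x. x \<in> {0..l} \<Longrightarrow> (u has_vector_derivative u' x) (at x within {0..l})"
    and u': "\<And>x. x \<in> {0..l} \<Longrightarrow> (u' has_vector_derivative - complex_of_real t * u x) (at x within {0..l})"
    and x: "x \<in> {0..l}"
  shows "u x = u 0 * cos_sol t x + u' 0 * sin_sol t x"
    "u' x = - complex_of_real t * u 0 * sin_sol t x + u' 0 * cos_sol t x"
proof -
  let ?C = "cos_sol t x" and ?S = "sin_sol t x"
  have "\<exists>c. \<forall>x\<in>{0..l}. u x * cos_sol t x - u' x * sin_sol t x = c"
  proof (rule has_vector_derivative_zero_constant)
    fix x assume x: "x \<in> {0..l}"
    show "((\<lambda>x. u x * cos_sol t x - u' x * sin_sol t x) has_vector_derivative 0) (at x within {0..l})"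
      by (rule has_vector_derivative_eq_rhs,
          rule has_vector_derivative_diff[OF
            has_vector_derivative_mult[OF u[OF x] cos_sol_deriv]
            has_vector_derivative_mult[OF u'[OF x] sin_sol_deriv]])
        (simp add: algebra_simps)
  qed auto
  then obtain c where c: "\<forall>x\<in>{0..l}. u x * cos_sol t x - u' x * sin_sol t x = c" by blast
  have 1: "u x * ?C - u' x * ?S = u 0" using c[rule_format, of 0] c[rule_format, of x] x by simp
  have "\<exists>c. \<forall>x\<in>{0..l}. t * (u x * sin_sol t x) + u' x * cos_sol t x = c"
  proof (rule has_vector_derivative_zero_constant)
    fix x assume x: "x \<in> {0..l}"
    show "((\<lambda>x. t * (u x * sin_sol t x) + u' x * cos_sol t x) has_vector_derivative 0) (at x within {0..l})"
      by (rule has_vector_derivative_eq_rhs,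
          rule has_vector_derivative_add[OF
            has_vector_derivative_mult_right[OF has_vector_derivative_mult[OF u[OF x] sin_sol_deriv]]
            has_vector_derivative_mult[OF u'[OF x] cos_sol_deriv]])
        (simp add: algebra_simps)
  qed auto
  then obtain c where c: "\<forall>x\<in>{0..l}. t * (u x * sin_sol t x) + u' x * cos_sol t x = c" by blast
  have 2: "t * (u x * ?S) + u' x * ?C = u' 0" using c[rule_format, of 0] c[rule_format, of x] x by simp
  have "u 0 * ?C + u' 0 * ?S = u x * (?C * ?C + t * (?S * ?S))"
    unfolding 1[symmetric] 2[symmetric] by (simp add: algebra_simps)
  then show "u x = u 0 * ?C + u' 0 * ?S" by (simp add: cos_sin_sol_identity)
  have "- complex_of_real t * u 0 * ?S + u' 0 * ?C = u' x * (?C * ?C + t * (?S * ?S))"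
    unfolding 1[symmetric] 2[symmetric] by (simp add: algebra_simps)
  then show "u' x = - complex_of_real t * u 0 * ?S + u' 0 * ?C" by (simp add: cos_sin_sol_identity)
qed

lemma csqrt_real_eq:
  assumes "0 \<le> r" shows "csqrt (complex_of_real (r\<^sup>2)) = complex_of_real r"
  using assms by (intro csqrt_unique) (auto simp flip: of_real_power)

text \<open>The complex cosine takes the value 1 only at real points, so the root of
  \<open>t\<close> is real and negative \<open>t\<close> is excluded. The sign of the integer
  disappears on squaring.\<close>

lemma cos_sol_eq_1_iff:
  assumes "0 < L"
  shows "cos_sol t L = 1 \<longleftrightarrow> (\<exists>m::nat. t = (2 * real m * pi / L)\<^sup>2)"
proof
  assume "cos_sol t L = 1"
  then obtain n where "csqrt (complex_of_real t) * complex_of_real L = complex_of_real (real_of_int (2 * n) * pi)"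
    by (auto simp: cos_sol_def cos_eq_1)
  then have "csqrt (complex_of_real t) = complex_of_real (2 * n * pi / L)"
    using assms by (simp add: field_simps)
  then have "complex_of_real t = complex_of_real ((2 * n * pi / L)\<^sup>2)"
    by (metis power2_csqrt of_real_power)
  then have "t = (2 * n * pi / L)\<^sup>2" using of_real_eq_iff by blast
  also have "\<dots> = (2 * real (nat \<bar>n\<bar>) * pi / L)\<^sup>2"
    by (cases "n \<ge> 0") (auto simp: power2_eq_square)
  finally show "\<exists>m::nat. t = (2 * real m * pi / L)\<^sup>2" by blast
next
  assume "\<exists>m::nat. t = (2 * real m * pi / L)\<^sup>2"
  then obtain m :: nat where t: "t = (2 * real m * pi / L)\<^sup>2" by blast
  have "csqrt (complex_of_real t) = complex_of_real (2 * real m * pi / L)"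
    unfolding t using assms by (intro csqrt_real_eq) simp
  then have "csqrt (complex_of_real t) * complex_of_real L = complex_of_real (2 * real m * pi)"
    using assms by simp
  then have "cos_sol t L = complex_of_real (cos (2 * real m * pi))"
    unfolding cos_sol_def by (simp only: cos_of_real)
  also have "cos (2 * real m * pi) = 1" by (rule cos_2npi)
  finally show "cos_sol t L = 1" by simp
qed

lemma complex_cos_eq_minus_1: "cos z = -1 \<longleftrightarrow> cos (z - complex_of_real pi) = 1"
  by (auto simp: cos_diff minus_equation_iff[of "cos z"] cos_of_real sin_of_real)

lemma cos_sol_eq_minus_1_iff:
  assumes "0 < L"
  shows "cos_sol t L = -1 \<longleftrightarrow> (\<exists>m::nat. t = ((2 * real m + 1) * pi / L)\<^sup>2)"
proof
  assume "cos_sol t L = -1"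
  then obtain n where "csqrt (complex_of_real t) * complex_of_real L - complex_of_real pi = complex_of_real (real_of_int (2 * n) * pi)"
    by (auto simp: cos_sol_def complex_cos_eq_minus_1 cos_eq_1)
  then have "csqrt (complex_of_real t) = complex_of_real ((2 * real_of_int n + 1) * pi / L)"
    using assms by (simp add: field_simps)
  then have "complex_of_real t = complex_of_real (((2 * real_of_int n + 1) * pi / L)\<^sup>2)"
    by (metis power2_csqrt of_real_power)
  then have t: "t = ((2 * real_of_int n + 1) * pi / L)\<^sup>2" using of_real_eq_iff by blast
  show "\<exists>m::nat. t = ((2 * real m + 1) * pi / L)\<^sup>2"
  proof (cases "n \<ge> 0")
    case True
    then show ?thesis using t by (intro exI[of _ "nat n"]) simp
  next
    case False
    \<comment> \<open>For negative \<open>n\<close> the odd number \<open>2 * n + 1\<close> is the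
      negative of \<open>2 * (- n - 1) + 1\<close>.\<close>
    then have "real (nat (- n - 1)) = - real_of_int n - 1" by simp
    then have "2 * real (nat (- n - 1)) + 1 = - (2 * real_of_int n + 1)" by simp
    then have "((2 * real (nat (- n - 1)) + 1) * pi / L)\<^sup>2 = ((2 * real_of_int n + 1) * pi / L)\<^sup>2"
      by (simp only: mult_minus_left minus_divide_left[symmetric] power2_minus)
    then show ?thesis using t by metis
  qed
next
  assume "\<exists>m::nat. t = ((2 * real m + 1) * pi / L)\<^sup>2"
  then obtain m :: nat where t: "t = ((2 * real m + 1) * pi / L)\<^sup>2" by blast
  have "csqrt (complex_of_real t) = complex_of_real ((2 * real m + 1) * pi / L)"
    unfolding t using assms by (intro csqrt_real_eq) simp
  then have "csqrt (complex_of_real t) * complex_of_real L = complex_of_real ((2 * real m + 1) * pi)"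
    using assms by simp
  then have "cos_sol t L = complex_of_real (cos ((2 * real m + 1) * pi))"
    unfolding cos_sol_def by (simp only: cos_of_real)
  also have "cos ((2 * real m + 1) * pi) = - cos (2 * real m * pi)"
    by (simp only: distrib_right mult_1 cos_periodic_pi)
  also have "cos (2 * real m * pi) = 1" by (rule cos_2npi)
  finally show "cos_sol t L = -1" by simp
qed

section \<open>Waves: regularity and data at the vertices\<close>

lemma lipschitz_imp_abs_continuous_on:
  fixes f :: "real \<Rightarrow> 'a::real_normed_vector"
  assumes B: "\<And>x y. x \<in> S \<Longrightarrow> y \<in> S \<Longrightarrow> norm (f x - f y) \<le> B * \<bar>x - y\<bar>"
  shows "abs_continuous_on S f"
  unfolding abs_continuous_on_def
proof (intro allI impI)
  fix \<epsilon> :: real assume "0 < \<epsilon>"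
  have "(\<Sum>K\<in>D. norm (f (Sup K) - f (Inf K))) < \<epsilon>"
    if D: "D division_of T" "T \<subseteq> S" "(\<Sum>K\<in>D. Sup K - Inf K) < \<epsilon> / (\<bar>B\<bar> + 1)" for D T
  proof -
    have "norm (f (Sup K) - f (Inf K)) \<le> (\<bar>B\<bar> + 1) * (Sup K - Inf K)" if K: "K \<in> D" for K
    proof -
      obtain x y where xy: "K = {x..y}" "x \<le> y"
        using division_ofD(3,4)[OF D(1) K] by (metis box_real(2) atLeastatMost_empty_iff2)
      then have "x \<in> K" "y \<in> K" by auto
      then have "x \<in> S" "y \<in> S" using division_ofD(2)[OF D(1) K] D(2) by blast+
      then have "norm (f y - f x) \<le> B * (y - x)" using B[of y x] xy by simp
      also have "\<dots> \<le> (\<bar>B\<bar> + 1) * (y - x)" using xy by (intro mult_right_mono) auto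
      finally show ?thesis using xy by simp
    qed
    then have "(\<Sum>K\<in>D. norm (f (Sup K) - f (Inf K))) \<le> (\<bar>B\<bar> + 1) * (\<Sum>K\<in>D. Sup K - Inf K)"
      unfolding sum_distrib_left by (rule sum_mono)
    also have "\<dots> < \<epsilon>" using D(3) by (simp add: pos_less_divide_eq add_nonneg_pos mult.commute)
    finally show ?thesis .
  qed
  then show "\<exists>\<delta>>0. \<forall>D T. D division_of T \<and> T \<subseteq> S \<and> (\<Sum>K\<in>D. Sup K - Inf K) < \<delta> \<longrightarrow>
      (\<Sum>K\<in>D. norm (f (Sup K) - f (Inf K))) < \<epsilon>"
    using \<open>0 < \<epsilon>\<close> by (intro exI[of _ "\<epsilon> / (\<bar>B\<bar> + 1)"]) auto
qed

lemma continuous_deriv_imp_abs_continuous_on: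
  fixes f :: "real \<Rightarrow> complex"
  assumes f: "\<And>x. x \<in> {a..b} \<Longrightarrow> (f has_vector_derivative f' x) (at x within {a..b})"
    and f': "continuous_on {a..b} f'"
  shows "abs_continuous_on {a..b} f"
proof -
  have "bounded (f' ` {a..b})"
    by (intro compact_imp_bounded compact_continuous_image f' compact_Icc)
  then obtain B where B: "\<And>x. x \<in> {a..b} \<Longrightarrow> norm (f' x) \<le> B" unfolding bounded_iff by blast
  show ?thesis
  proof (rule lipschitz_imp_abs_continuous_on)
    fix x y assume xy: "x \<in> {a..b}" "y \<in> {a..b}"
    have "norm (f x - f y) \<le> B * norm (x - y)"
    proof (rule differentiable_bound[of "{a..b}" f "\<lambda>x h. h *\<^sub>R f' x"])
      show "(f has_derivative (\<lambda>h. h *\<^sub>R f' x)) (at x within {a..b})" if "x \<in> {a..b}" for x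
        using f[OF that] by (simp add: has_vector_derivative_def)
      show "onorm (\<lambda>h. h *\<^sub>R f' x) \<le> B" if "x \<in> {a..b}" for x
      proof (rule onorm_le)
        show "norm (h *\<^sub>R f' x) \<le> B * norm h" for h
          using mult_left_mono[OF B[OF that], of "\<bar>h\<bar>"] by (simp add: mult.commute)
      qed
    qed (use xy in auto)
    then show "norm (f x - f y) \<le> B * \<bar>x - y\<bar>" by simp
  qed
qed

lemma continuous_imp_square_integrable_on:
  assumes "continuous_on {a..b} f"
  shows "square_integrable_on {a..b} f"
  unfolding square_integrable_on_def
proof
  show "f \<in> borel_measurable (lebesgue_on {a..b})"
    using assms by (rule continuous_imp_measurable_on_sets_lebesgue) simp
  show "integrable (lebesgue_on {a..b}) (\<lambda>x. (cmod (f x))\<^sup>2)"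
    by (intro continuous_imp_integrable_real continuous_intros assms)
qed

lemma square_integrable_on_cong:
  assumes "\<And>x. x \<in> S \<Longrightarrow> f x = g x" "S \<in> sets lebesgue"
  shows "square_integrable_on S f \<longleftrightarrow> square_integrable_on S g"
proof -
  have "f \<in> borel_measurable (lebesgue_on S) \<longleftrightarrow> g \<in> borel_measurable (lebesgue_on S)"
    by (rule measurable_cong) (use assms in \<open>auto simp: space_restrict_space\<close>)
  moreover have "integrable (lebesgue_on S) (\<lambda>x. (cmod (f x))\<^sup>2) \<longleftrightarrow> integrable (lebesgue_on S) (\<lambda>x. (cmod (g x))\<^sup>2)"
    by (rule Bochner_Integration.integrable_cong) (use assms in \<open>auto simp: space_restrict_space\<close>)
  ultimately show ?thesis by (simp add: square_integrable_on_def)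
qed

text \<open>\<open>p\<close> and \<open>q\<close> prescribe the value and the derivative at the initial point of every edge.\<close>

definition wave :: "'v mgraph \<Rightarrow> real \<Rightarrow> ('v \<times> 'v \<Rightarrow> complex) \<Rightarrow> ('v \<times> 'v \<Rightarrow> complex) \<Rightarrow> 'v graph_fun" where
  "wave G t p q = (\<lambda>e x. if e \<in> edges G \<and> x \<in> {0..edge_len G e}
     then p e * cos_sol t x + q e * sin_sol t x else 0)"

text \<open>On the edge \<open>f\<close> is differentiable everywhere, and the equation for the
  derivative of \<open>edge_deriv\<close>, known almost everywhere, becomes classical by
  \<open>abs_continuous_antiderivative\<close>.\<close>

lemma eigenfunction_on_edge:
  assumes f: "f \<in> anti_standard_eigenspace G t" and e: "e \<in> edges G" and l: "0 < edge_len G e"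
    and x: "x \<in> {0..edge_len G e}"
  shows "f e x = f e 0 * cos_sol t x + edge_deriv G f e 0 * sin_sol t x"
proof -
  let ?l = "edge_len G e"
  have dom: "f e differentiable_on {0..?l}" "abs_continuous_on {0..?l} (edge_deriv G f e)"
    and ae: "AE x in lebesgue_on {0..?l}. neg_laplace G f e x = complex_of_real t * f e x"
    using f e by (auto simp: anti_standard_eigenspace_def anti_standard_domain_def maximal_domain_def)
  have d1: "(f e has_vector_derivative edge_deriv G f e x) (at x within {0..?l})" if "x \<in> {0..?l}" for x
    using dom(1) that unfolding edge_deriv_def differentiable_on_def
    by (simp add: vector_derivative_works[symmetric])
  have cont: "continuous_on {0..?l} (\<lambda>x. - complex_of_real t * f e x)"
    by (intro continuous_intros differentiable_imp_continuous_on dom)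
  have ae': "AE x in lebesgue_on {0..?l}. vector_derivative (edge_deriv G f e) (at x within {0..?l})
      = - complex_of_real t * f e x"
    using ae unfolding neg_laplace_def edge_deriv_def[of G "edge_deriv G f" e]
    by eventually_elim (metis minus_equation_iff mult_minus_left)
  have d2: "(edge_deriv G f e has_vector_derivative - complex_of_real t * f e x) (at x within {0..?l})"
    if "x \<in> {0..?l}" for x
    by (rule abs_continuous_antiderivative[OF dom(2) l cont ae' that])
  show ?thesis by (rule initial_value_problem(1)[OF d1 d2 x])
qed

lemma eigenfunction_is_wave:
  assumes "f \<in> anti_standard_eigenspace G t" "\<And>e. e \<in> edges G \<Longrightarrow> 0 < edge_len G e"
  shows "f = wave G t (\<lambda>e. f e 0) (\<lambda>e. edge_deriv G f e 0)"
proof (intro ext)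
  fix e x
  show "f e x = wave G t (\<lambda>e. f e 0) (\<lambda>e. edge_deriv G f e 0) e x"
  proof (cases "e \<in> edges G \<and> x \<in> {0..edge_len G e}")
    case True
    then have "f e x = f e 0 * cos_sol t x + edge_deriv G f e 0 * sin_sol t x"
      using eigenfunction_on_edge[OF assms(1)] assms(2) by blast
    also have "\<dots> = wave G t (\<lambda>e. f e 0) (\<lambda>e. edge_deriv G f e 0) e x"
      unfolding wave_def if_P[OF True] ..
    finally show ?thesis .
  next
    case False
    then have "f e x = 0"
      using assms(1) unfolding anti_standard_eigenspace_def anti_standard_domain_def maximal_domain_def
      by blast
    with False show ?thesis unfolding wave_def if_not_P[OF False] by simp
  qed
qed

context
  fixes G :: "'v mgraph" and e :: "'v \<times> 'v"
  assumes e: "e \<in> edges G" and l: "0 < edge_len G e"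
begin

lemma wave_has_derivative:
  assumes "x \<in> {0..edge_len G e}"
  shows "(wave G t p q e has_vector_derivative q e * cos_sol t x - t * p e * sin_sol t x)
    (at x within {0..edge_len G e})"
proof (rule has_vector_derivative_transform[OF assms])
  show "((\<lambda>x. p e * cos_sol t x + q e * sin_sol t x) has_vector_derivative
      q e * cos_sol t x - t * p e * sin_sol t x) (at x within {0..edge_len G e})"
    by (rule has_vector_derivative_eq_rhs, rule has_vector_derivative_add[OF
          has_vector_derivative_mult_right[OF cos_sol_deriv]
          has_vector_derivative_mult_right[OF sin_sol_deriv]])
      (simp add: algebra_simps)
qed (use e in \<open>simp add: wave_def\<close>)

lemma wave_edge_deriv:
  assumes "x \<in> {0..edge_len G e}"
  shows "edge_deriv G (wave G t p q) e x = q e * cos_sol t x - t * p e * sin_sol t x"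
  unfolding edge_deriv_def
  by (rule vector_derivative_within_closed_interval[OF l assms wave_has_derivative[OF assms]])

lemma wave_edge_deriv_has_derivative:
  assumes "x \<in> {0..edge_len G e}"
  shows "(edge_deriv G (wave G t p q) e has_vector_derivative - (t * wave G t p q e x))
    (at x within {0..edge_len G e})"
proof (rule has_vector_derivative_transform[OF assms])
  show "((\<lambda>x. q e * cos_sol t x - t * p e * sin_sol t x) has_vector_derivative
      - (t * wave G t p q e x)) (at x within {0..edge_len G e})"
    by (rule has_vector_derivative_eq_rhs, rule has_vector_derivative_diff[OF
          has_vector_derivative_mult_right[OF cos_sol_deriv]
          has_vector_derivative_mult_right[OF sin_sol_deriv]])
      (use e assms in \<open>simp add: wave_def algebra_simps\<close>)
qed (rule wave_edge_deriv)

lemma wave_neg_laplace: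
  assumes "x \<in> {0..edge_len G e}"
  shows "neg_laplace G (wave G t p q) e x = t * wave G t p q e x"
proof -
  have "vector_derivative (edge_deriv G (wave G t p q) e) (at x within {0..edge_len G e})
      = - (t * wave G t p q e x)"
    by (rule vector_derivative_within_closed_interval[OF l assms wave_edge_deriv_has_derivative[OF assms]])
  then show ?thesis
    by (simp add: neg_laplace_def edge_deriv_def[of G "edge_deriv G (wave G t p q)"])
qed

end

lemma wave_maximal_domain:
  assumes pos: "\<And>e. e \<in> edges G \<Longrightarrow> 0 < edge_len G e"
  shows "wave G t p q \<in> maximal_domain G"
  unfolding maximal_domain_def
proof (intro CollectI conjI ballI allI impI)
  let ?w = "wave G t p q"
  show "?w e x = 0" if "e \<notin> edges G \<or> x \<notin> {0..edge_len G e}" for e x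
    using that by (auto simp: wave_def)
  fix e assume e: "e \<in> edges G"
  let ?l = "edge_len G e"
  note d1 = wave_has_derivative[OF e pos[OF e], of _ t p q]
  note d2 = wave_edge_deriv_has_derivative[OF e pos[OF e], of _ t p q]
  have c0: "continuous_on {0..?l} (?w e)"
    unfolding continuous_on_eq_continuous_within using has_vector_derivative_continuous[OF d1] by blast
  have c1: "continuous_on {0..?l} (edge_deriv G ?w e)"
    unfolding continuous_on_eq_continuous_within using has_vector_derivative_continuous[OF d2] by blast
  show "square_integrable_on {0..?l} (?w e)" by (rule continuous_imp_square_integrable_on[OF c0])
  show "?w e differentiable_on {0..?l}"
    using d1 unfolding differentiable_on_def by (blast intro: differentiableI_vector)
  have d1': "(?w e has_vector_derivative edge_deriv G ?w e x) (at x within {0..?l})" if "x \<in> {0..?l}" for x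
    using d1[OF that] wave_edge_deriv[OF e pos[OF e] that] by simp
  show "abs_continuous_on {0..?l} (?w e)"
    by (rule continuous_deriv_imp_abs_continuous_on[OF d1' c1])
  have c2: "continuous_on {0..?l} (\<lambda>x. - (complex_of_real t * ?w e x))"
    by (intro continuous_intros c0)
  show "abs_continuous_on {0..?l} (edge_deriv G ?w e)"
    by (rule continuous_deriv_imp_abs_continuous_on[OF d2 c2])
  have "continuous_on {0..?l} (\<lambda>x. complex_of_real t * ?w e x)"
    by (intro continuous_intros c0)
  then have "square_integrable_on {0..?l} (\<lambda>x. complex_of_real t * ?w e x)"
    by (rule continuous_imp_square_integrable_on)
  moreover have "square_integrable_on {0..?l} (neg_laplace G ?w e) \<longleftrightarrow>
      square_integrable_on {0..?l} (\<lambda>x. complex_of_real t * ?w e x)"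
    by (rule square_integrable_on_cong[OF wave_neg_laplace[OF e pos[OF e]]]) simp_all
  ultimately show "square_integrable_on {0..?l} (neg_laplace G ?w e)" by simp
qed

lemma wave_vertex_value:
  assumes "e \<in> edges G" "0 < edge_len G e"
  shows "vertex_value G (wave G t p q) v e =
    (if v = fst e then p e else p e * cos_sol t (edge_len G e) + q e * sin_sol t (edge_len G e))"
  using assms by (simp add: vertex_value_def wave_def)

lemma wave_outgoing_deriv:
  assumes "e \<in> edges G" "0 < edge_len G e"
  shows "outgoing_deriv G (wave G t p q) v e =
    (if v = fst e then q e else t * p e * sin_sol t (edge_len G e) - q e * cos_sol t (edge_len G e))"
  using wave_edge_deriv[OF assms, of 0 t p q] wave_edge_deriv[OF assms, of "edge_len G e" t p q] assms(2)
  by (simp add: outgoing_deriv_def)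

definition vertex_conditions :: "'v mgraph \<Rightarrow> 'v graph_fun \<Rightarrow> bool" where
  "vertex_conditions G f \<longleftrightarrow> (\<forall>v \<in> set (vertices G).
     (\<forall>e \<in> incident_edges G v. \<forall>e' \<in> incident_edges G v.
        outgoing_deriv G f v e = outgoing_deriv G f v e') \<and>
     (\<Sum>e \<in> incident_edges G v. vertex_value G f v e) = 0)"

text \<open>Every wave is regular enough for \<open>maximal_domain\<close>, so from here on only
  linear algebra in the initial data \<open>p\<close> and \<open>q\<close> remains.\<close>

lemma anti_standard_eigenspace_eq_waves:
  assumes pos: "\<And>e. e \<in> edges G \<Longrightarrow> 0 < edge_len G e"
  shows "anti_standard_eigenspace G t = {wave G t p q | p q. vertex_conditions G (wave G t p q)}"
proof (intro equalityI subsetI)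
  fix f assume f: "f \<in> anti_standard_eigenspace G t"
  then have "vertex_conditions G f"
    unfolding anti_standard_eigenspace_def anti_standard_domain_def vertex_conditions_def by blast
  then have "vertex_conditions G (wave G t (\<lambda>e. f e 0) (\<lambda>e. edge_deriv G f e 0))"
    using eigenfunction_is_wave[OF f pos] by simp
  with eigenfunction_is_wave[OF f pos]
  show "f \<in> {wave G t p q | p q. vertex_conditions G (wave G t p q)}" by blast
next
  fix f assume "f \<in> {wave G t p q | p q. vertex_conditions G (wave G t p q)}"
  then obtain p q where f: "f = wave G t p q" "vertex_conditions G f" by blast
  have "AE x in lebesgue_on {0..edge_len G e}. neg_laplace G f e x = complex_of_real t * f e x"
    if "e \<in> edges G" for e
    unfolding f(1) by (rule AE_I2, rule wave_neg_laplace[OF that pos[OF that]])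
      (simp add: space_restrict_space)
  moreover have "f \<in> maximal_domain G" unfolding f(1) by (rule wave_maximal_domain[OF pos])
  ultimately show "f \<in> anti_standard_eigenspace G t"
    using f(2) unfolding anti_standard_eigenspace_def anti_standard_domain_def vertex_conditions_def
    by blast
qed

section \<open>The spectrum of a cycle\<close>

text \<open>With \<open>c N = c 0\<close> the closing edge has the same form as the others, and edge
  \<open>i\<close> leads from \<open>c i\<close> to \<open>c (Suc i)\<close> for all
  \<open>i < N\<close>.\<close>

locale cycle_graph =
  fixes G :: "'v mgraph" and c :: "nat \<Rightarrow> 'v" and N :: nat and l :: real
  assumes N3: "3 \<le> N" and l_pos: "0 < l"
    and inj_c: "inj_on c {..<N}" and c_N: "c N = c 0"
    and vertices_eq: "set (vertices G) = c ` {..<N}"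
    and adjacent_iff: "\<And>u v. adjacent G u v \<longleftrightarrow> (\<exists>i<N. {u, v} = {c i, c (Suc i)})"
    and asym_edges: "\<And>u v. (u, v) \<in> edges G \<Longrightarrow> (v, u) \<notin> edges G"
    and edge_len_eq: "\<And>e. e \<in> edges G \<Longrightarrow> edge_len G e = l"
begin

text \<open>\<open>edges G\<close> stores one orientation of each edge, which need not follow the
  cycle.\<close>

definition forward :: "nat \<Rightarrow> bool" where
  "forward i \<longleftrightarrow> (c i, c (Suc i)) \<in> edges G"

definition cycle_edge :: "nat \<Rightarrow> 'v \<times> 'v" where
  "cycle_edge i = (if forward i then (c i, c (Suc i)) else (c (Suc i), c i))"

lemma c_eq_iff: "i < N \<Longrightarrow> j < N \<Longrightarrow> c i = c j \<longleftrightarrow> i = j"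
  using inj_c by (auto simp: inj_on_def)

text \<open>\<open>Suc i\<close> may be \<open>N\<close>, outside the range where \<open>c\<close>
  and \<open>cycle_edge\<close> are injective; the wrapped index stays inside.\<close>

definition next_index :: "nat \<Rightarrow> nat" where
  "next_index i = (if Suc i = N then 0 else Suc i)"

lemma c_Suc: "i < N \<Longrightarrow> c (Suc i) = c (next_index i)"
  using c_N by (auto simp: next_index_def)

lemma next_index_less: "i < N \<Longrightarrow> next_index i < N"
  using N3 by (auto simp: next_index_def)

lemma next_index_neq: "i < N \<Longrightarrow> next_index i \<noteq> i"
  using N3 by (auto simp: next_index_def)

lemma next_index_eq_iff: "i < N \<Longrightarrow> j < N \<Longrightarrow> next_index i = next_index j \<longleftrightarrow> i = j"
  by (auto simp: next_index_def)

lemma c_Suc_neq: "i < N \<Longrightarrow> c (Suc i) \<noteq> c i"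
  by (simp add: c_Suc c_eq_iff next_index_less next_index_neq)

lemma cycle_edge_in_edges: "i < N \<Longrightarrow> cycle_edge i \<in> edges G"
proof -
  assume "i < N"
  then have "adjacent G (c i) (c (Suc i))" using adjacent_iff by blast
  then show ?thesis by (auto simp: cycle_edge_def forward_def adjacent_def)
qed

lemma ends_eq: "i < N \<Longrightarrow> {fst (cycle_edge i), snd (cycle_edge i)} = {c i, c (Suc i)}"
  by (auto simp: cycle_edge_def)

text \<open>Two different edges with the same ends would each be the successor of the other, which
  happens only in a cycle of length 2.\<close>

lemma ends_inj:
  assumes "i < N" "j < N" "{c i, c (Suc i)} = {c j, c (Suc j)}"
  shows "i = j"
proof (rule ccontr)
  assume "i \<noteq> j"
  then have "c i \<noteq> c j" using c_eq_iff assms by simp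
  then have "c i = c (Suc j)" "c j = c (Suc i)" using assms(3) by (auto simp: doubleton_eq_iff)
  then have "i = next_index j" "j = next_index i"
    using assms c_eq_iff by (auto simp: c_Suc next_index_less)
  then show False using N3 by (auto simp: next_index_def split: if_splits)
qed

lemma inj_cycle_edge: "inj_on cycle_edge {..<N}"
proof (rule inj_onI)
  fix i j assume "i \<in> {..<N}" "j \<in> {..<N}" "cycle_edge i = cycle_edge j"
  then show "i = j" using ends_eq[of i] ends_eq[of j] ends_inj[of i j] by simp
qed

lemma edges_eq: "edges G = cycle_edge ` {..<N}"
proof
  show "cycle_edge ` {..<N} \<subseteq> edges G" using cycle_edge_in_edges by auto
  show "edges G \<subseteq> cycle_edge ` {..<N}"
  proof
    fix e assume e: "e \<in> edges G"
    obtain u v where uv: "e = (u, v)" by (cases e)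
    then have "adjacent G u v" using e by (simp add: adjacent_def)
    then obtain i where i: "i < N" "{u, v} = {c i, c (Suc i)}" using adjacent_iff by blast
    have "e = cycle_edge i"
      using i(2) e uv asym_edges unfolding cycle_edge_def forward_def doubleton_eq_iff by auto
    with i show "e \<in> cycle_edge ` {..<N}" by blast
  qed
qed

lemma incident_edges_eq:
  assumes "i < N"
  shows "incident_edges G (c (Suc i)) = {cycle_edge i, cycle_edge (next_index i)}"
proof
  show "{cycle_edge i, cycle_edge (next_index i)} \<subseteq> incident_edges G (c (Suc i))"
    using assms cycle_edge_in_edges next_index_less[OF assms]
    by (auto simp: incident_edges_def cycle_edge_def c_Suc)
  show "incident_edges G (c (Suc i)) \<subseteq> {cycle_edge i, cycle_edge (next_index i)}"
  proof
    fix e assume "e \<in> incident_edges G (c (Suc i))"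
    then obtain j where j: "e = cycle_edge j" "j < N" "c (Suc i) \<in> {fst e, snd e}"
      by (auto simp: incident_edges_def edges_eq)
    then have "c (Suc i) = c j \<or> c (Suc i) = c (Suc j)" using ends_eq[of j] by auto
    then have "next_index i = j \<or> i = j"
      using j(2) assms c_eq_iff next_index_less next_index_eq_iff by (auto simp: c_Suc)
    with j show "e \<in> {cycle_edge i, cycle_edge (next_index i)}" by auto
  qed
qed

text \<open>Indexing a vertex by the edge that arrives there places it between
  \<open>cycle_edge i\<close> and \<open>cycle_edge (next_index i)\<close>.\<close>

lemma vertices_eq': "set (vertices G) = (\<lambda>i. c (Suc i)) ` {..<N}"
proof
  show "(\<lambda>i. c (Suc i)) ` {..<N} \<subseteq> set (vertices G)"
    using next_index_less by (auto simp: vertices_eq c_Suc)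
  show "set (vertices G) \<subseteq> (\<lambda>i. c (Suc i)) ` {..<N}"
  proof
    fix v assume "v \<in> set (vertices G)"
    then obtain k where k: "k < N" "v = c k" using vertices_eq by auto
    show "v \<in> (\<lambda>i. c (Suc i)) ` {..<N}"
    proof (cases k)
      case 0
      then have "v = c (Suc (N - 1))" using k N3 c_N by simp
      then show ?thesis using N3 by (intro image_eqI[of _ _ "N - 1"]) auto
    next
      case (Suc i)
      then show ?thesis using k by auto
    qed
  qed
qed

lemma edge_len_pos: "e \<in> edges G \<Longrightarrow> 0 < edge_len G e"
  using edge_len_eq l_pos by simp

lemma vertex_conditions_iff:
  "vertex_conditions G f \<longleftrightarrow> (\<forall>i<N.
     vertex_value G f (c (Suc i)) (cycle_edge i) + vertex_value G f (c (Suc i)) (cycle_edge (next_index i)) = 0 \<and>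
     outgoing_deriv G f (c (Suc i)) (cycle_edge i) = outgoing_deriv G f (c (Suc i)) (cycle_edge (next_index i)))"
proof -
  have "cycle_edge i \<noteq> cycle_edge (next_index i)" if "i < N" for i
    using inj_cycle_edge next_index_neq[OF that] next_index_less[OF that] that by (metis inj_onD lessThan_iff)
  then have "(\<Sum>e \<in> incident_edges G (c (Suc i)). vertex_value G f (c (Suc i)) e) =
      vertex_value G f (c (Suc i)) (cycle_edge i) + vertex_value G f (c (Suc i)) (cycle_edge (next_index i))"
    if "i < N" for i
    using that by (simp add: incident_edges_eq)
  moreover have "(\<forall>e \<in> incident_edges G (c (Suc i)). \<forall>e' \<in> incident_edges G (c (Suc i)).
        outgoing_deriv G f (c (Suc i)) e = outgoing_deriv G f (c (Suc i)) e') \<longleftrightarrow>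
      outgoing_deriv G f (c (Suc i)) (cycle_edge i) = outgoing_deriv G f (c (Suc i)) (cycle_edge (next_index i))"
    if "i < N" for i
    using that by (auto simp: incident_edges_eq)
  ultimately show ?thesis unfolding vertex_conditions_def vertices_eq' by auto
qed

context
  fixes t :: real
begin

abbreviation "C1 \<equiv> cos_sol t l"
abbreviation "S1 \<equiv> sin_sol t l"

lemma step_identity: "x * (C1 * C1) + complex_of_real t * (x * (S1 * S1)) = x"
  using arg_cong[OF cos_sin_sol_identity[of t l], of "(*) x"] by (simp add: algebra_simps)

text \<open>\<open>start_value\<close> and \<open>start_deriv\<close> are the initial data of a wave on the \<open>i\<close>-th edge of the cycle, when
  that edge is traversed from \<open>c i\<close> to \<open>c (Suc i)\<close> regardless of its orientation in \<open>G\<close>.\<close>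

definition start_value :: "('v \<times> 'v \<Rightarrow> complex) \<Rightarrow> ('v \<times> 'v \<Rightarrow> complex) \<Rightarrow> nat \<Rightarrow> complex" where
  "start_value p q i = (let e = cycle_edge i in if forward i then p e else p e * C1 + q e * S1)"

definition start_deriv :: "('v \<times> 'v \<Rightarrow> complex) \<Rightarrow> ('v \<times> 'v \<Rightarrow> complex) \<Rightarrow> nat \<Rightarrow> complex" where
  "start_deriv p q i = (let e = cycle_edge i in if forward i then q e else complex_of_real t * p e * S1 - q e * C1)"

text \<open>With outgoing derivatives at both ends, changing ends sends \<open>(a, b)\<close> to
  \<open>(a * C1 + b * S1, t * a * S1 - b * C1)\<close>. By \<open>step_identity\<close> this is an
  involution, so an edge stored backwards obeys the same formulas.\<close>

lemma wave_values:
  fixes p q :: "'v \<times> 'v \<Rightarrow> complex"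
  assumes "i < N"
  defines "a \<equiv> start_value p q i" and "b \<equiv> start_deriv p q i"
  shows "vertex_value G (wave G t p q) (c i) (cycle_edge i) = a"
    and "outgoing_deriv G (wave G t p q) (c i) (cycle_edge i) = b"
    and "vertex_value G (wave G t p q) (c (Suc i)) (cycle_edge i) = a * C1 + b * S1"
    and "outgoing_deriv G (wave G t p q) (c (Suc i)) (cycle_edge i) = complex_of_real t * a * S1 - b * C1"
proof -
  note e = cycle_edge_in_edges[OF assms(1)]
  note rules = wave_vertex_value[OF e edge_len_pos[OF e]] wave_outgoing_deriv[OF e edge_len_pos[OF e]]
    edge_len_eq[OF e]
  have fst: "fst (cycle_edge i) = (if forward i then c i else c (Suc i))" by (simp add: cycle_edge_def)
  note neq = c_Suc_neq[OF assms(1)] c_Suc_neq[OF assms(1), symmetric]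
  show "vertex_value G (wave G t p q) (c i) (cycle_edge i) = a"
    "outgoing_deriv G (wave G t p q) (c i) (cycle_edge i) = b"
    by (simp_all add: rules fst neq a_def b_def start_value_def start_deriv_def Let_def)
  let ?p = "p (cycle_edge i)" and ?q = "q (cycle_edge i)"
  have "(?p * C1 + ?q * S1) * C1 + (complex_of_real t * ?p * S1 - ?q * C1) * S1 = ?p * (C1 * C1) + complex_of_real t * (?p * (S1 * S1))"
    "complex_of_real t * (?p * C1 + ?q * S1) * S1 - (complex_of_real t * ?p * S1 - ?q * C1) * C1 = ?q * (C1 * C1) + complex_of_real t * (?q * (S1 * S1))"
    by (simp_all add: algebra_simps)
  then have ends: "(?p * C1 + ?q * S1) * C1 + (complex_of_real t * ?p * S1 - ?q * C1) * S1 = ?p"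
    "complex_of_real t * (?p * C1 + ?q * S1) * S1 - (complex_of_real t * ?p * S1 - ?q * C1) * C1 = ?q"
    by (simp_all only: step_identity)
  show "vertex_value G (wave G t p q) (c (Suc i)) (cycle_edge i) = a * C1 + b * S1"
    "outgoing_deriv G (wave G t p q) (c (Suc i)) (cycle_edge i) = complex_of_real t * a * S1 - b * C1"
    by (simp_all add: rules fst neq a_def b_def start_value_def start_deriv_def Let_def ends)
qed

text \<open>The outgoing derivative along the arriving edge is minus the derivative in the direction
  of travel; hence the same minus sign in front of value and derivative.\<close>

lemma wave_vertex_conditions_iff:
  "vertex_conditions G (wave G t p q) \<longleftrightarrow> (\<forall>i<N.
     start_value p q (next_index i) = - (start_value p q i * C1 + start_deriv p q i * S1) \<and>
     start_deriv p q (next_index i) = - (start_deriv p q i * C1 - complex_of_real t * start_value p q i * S1))"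
proof -
  have "vertex_value G (wave G t p q) (c (Suc i)) (cycle_edge (next_index i)) = start_value p q (next_index i)"
    "outgoing_deriv G (wave G t p q) (c (Suc i)) (cycle_edge (next_index i)) = start_deriv p q (next_index i)"
    if "i < N" for i
    using wave_values(1,2)[OF next_index_less[OF that]] by (simp_all add: c_Suc[OF that])
  then show ?thesis
    unfolding vertex_conditions_iff
    by (auto simp: wave_values(3,4) add_eq_0_iff2 eq_commute[of _ "start_deriv p q (next_index _)"]
        eq_neg_iff_add_eq_0 add.commute)
qed

end

end

context cycle_graph
begin

text \<open>The solution of \<open>u'' = - t u\<close> with initial data \<open>(x, y)\<close> is continued around the cycle;
  the vertex conditions flip its sign at every vertex.\<close>

definition unrolled_value :: "real \<Rightarrow> complex \<Rightarrow> complex \<Rightarrow> nat \<Rightarrow> complex" where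
  "unrolled_value t x y i = (- 1) ^ i * (x * cos_sol t (real i * l) + y * sin_sol t (real i * l))"

definition unrolled_deriv :: "real \<Rightarrow> complex \<Rightarrow> complex \<Rightarrow> nat \<Rightarrow> complex" where
  "unrolled_deriv t x y i =
    (- 1) ^ i * (y * cos_sol t (real i * l) - complex_of_real t * x * sin_sol t (real i * l))"

lemma unrolled_0 [simp]: "unrolled_value t x y 0 = x" "unrolled_deriv t x y 0 = y"
  by (simp_all add: unrolled_value_def unrolled_deriv_def)

text \<open>The addition theorems compose the transfers over \<open>i * l\<close> and
  \<open>l\<close>, and the extra vertex contributes the factor -1.\<close>

lemma unrolled_Suc:
  "unrolled_value t x y (Suc i) =
    - (unrolled_value t x y i * cos_sol t l + unrolled_deriv t x y i * sin_sol t l)"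
  "unrolled_deriv t x y (Suc i) =
    - (unrolled_deriv t x y i * cos_sol t l - complex_of_real t * unrolled_value t x y i * sin_sol t l)"
proof -
  have *: "real (Suc i) * l = real i * l + l" by (simp add: algebra_simps)
  show "unrolled_value t x y (Suc i) =
      - (unrolled_value t x y i * cos_sol t l + unrolled_deriv t x y i * sin_sol t l)"
    "unrolled_deriv t x y (Suc i) =
      - (unrolled_deriv t x y i * cos_sol t l - complex_of_real t * unrolled_value t x y i * sin_sol t l)"
    unfolding unrolled_value_def unrolled_deriv_def * cos_sol_add sin_sol_add
    by (simp_all add: algebra_simps)
qed

text \<open>For an edge stored backwards \<open>wave\<close> expects the data at the far end, with
  the outgoing derivative there.\<close>

definition mode_value :: "real \<Rightarrow> complex \<Rightarrow> complex \<Rightarrow> 'v \<times> 'v \<Rightarrow> complex" where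
  "mode_value t x y e = (let i = the_inv_into {..<N} cycle_edge e in
     if forward i then unrolled_value t x y i
     else unrolled_value t x y i * cos_sol t l + unrolled_deriv t x y i * sin_sol t l)"

definition mode_deriv :: "real \<Rightarrow> complex \<Rightarrow> complex \<Rightarrow> 'v \<times> 'v \<Rightarrow> complex" where
  "mode_deriv t x y e = (let i = the_inv_into {..<N} cycle_edge e in
     if forward i then unrolled_deriv t x y i
     else complex_of_real t * unrolled_value t x y i * sin_sol t l - unrolled_deriv t x y i * cos_sol t l)"

definition mode :: "real \<Rightarrow> complex \<Rightarrow> complex \<Rightarrow> 'v graph_fun" where
  "mode t x y = wave G t (mode_value t x y) (mode_deriv t x y)"

lemma reflection_involutive:
  fixes a b :: complex
  shows "(a * cos_sol t l + b * sin_sol t l) * cos_sol t l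
      + (complex_of_real t * a * sin_sol t l - b * cos_sol t l) * sin_sol t l = a"
    "complex_of_real t * (a * cos_sol t l + b * sin_sol t l) * sin_sol t l
      - (complex_of_real t * a * sin_sol t l - b * cos_sol t l) * cos_sol t l = b"
proof -
  have "(a * cos_sol t l + b * sin_sol t l) * cos_sol t l
      + (complex_of_real t * a * sin_sol t l - b * cos_sol t l) * sin_sol t l
      = a * (cos_sol t l * cos_sol t l) + complex_of_real t * (a * (sin_sol t l * sin_sol t l))"
    "complex_of_real t * (a * cos_sol t l + b * sin_sol t l) * sin_sol t l
      - (complex_of_real t * a * sin_sol t l - b * cos_sol t l) * cos_sol t l
      = b * (cos_sol t l * cos_sol t l) + complex_of_real t * (b * (sin_sol t l * sin_sol t l))"
    by (simp_all add: algebra_simps)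
  then show "(a * cos_sol t l + b * sin_sol t l) * cos_sol t l
      + (complex_of_real t * a * sin_sol t l - b * cos_sol t l) * sin_sol t l = a"
    "complex_of_real t * (a * cos_sol t l + b * sin_sol t l) * sin_sol t l
      - (complex_of_real t * a * sin_sol t l - b * cos_sol t l) * cos_sol t l = b"
    by (simp_all only: step_identity)
qed

lemma start_mode:
  assumes "i < N"
  shows "start_value t (mode_value t x y) (mode_deriv t x y) i = unrolled_value t x y i"
    and "start_deriv t (mode_value t x y) (mode_deriv t x y) i = unrolled_deriv t x y i"
proof -
  have "the_inv_into {..<N} cycle_edge (cycle_edge i) = i"
    by (rule the_inv_into_f_f[OF inj_cycle_edge]) (use assms in simp)
  then show "start_value t (mode_value t x y) (mode_deriv t x y) i = unrolled_value t x y i"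
    "start_deriv t (mode_value t x y) (mode_deriv t x y) i = unrolled_deriv t x y i"
    by (simp_all add: start_value_def start_deriv_def mode_value_def mode_deriv_def Let_def
        reflection_involutive)
qed

definition closes_up :: "real \<Rightarrow> complex \<Rightarrow> complex \<Rightarrow> bool" where
  "closes_up t x y \<longleftrightarrow> unrolled_value t x y N = x \<and> unrolled_deriv t x y N = y"

lemma mode_vertex_conditions:
  assumes "closes_up t x y"
  shows "vertex_conditions G (mode t x y)"
  unfolding mode_def wave_vertex_conditions_iff
proof (intro allI impI)
  fix i assume i: "i < N"
  have "unrolled_value t x y (next_index i) = unrolled_value t x y (Suc i)"
    "unrolled_deriv t x y (next_index i) = unrolled_deriv t x y (Suc i)"
    using assms by (auto simp: next_index_def closes_up_def)
  then show "start_value t (mode_value t x y) (mode_deriv t x y) (next_index i) =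
      - (start_value t (mode_value t x y) (mode_deriv t x y) i * cos_sol t l +
         start_deriv t (mode_value t x y) (mode_deriv t x y) i * sin_sol t l) \<and>
    start_deriv t (mode_value t x y) (mode_deriv t x y) (next_index i) =
      - (start_deriv t (mode_value t x y) (mode_deriv t x y) i * cos_sol t l -
         complex_of_real t * start_value t (mode_value t x y) (mode_deriv t x y) i * sin_sol t l)"
    using unrolled_Suc[of t x y i] by (simp add: start_mode i next_index_less)
qed

lemma wave_cong:
  assumes "\<And>e. e \<in> edges G \<Longrightarrow> p e = p' e \<and> q e = q' e"
  shows "wave G t p q = wave G t p' q'"
  using assms by (auto simp: wave_def fun_eq_iff)

text \<open>The vertex conditions propagate the data of edge 0 along the cycle and determine all
  others; the condition from \<open>N - 1\<close> back to 0 is \<open>closes_up\<close>.\<close>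

lemma wave_is_mode:
  assumes "vertex_conditions G (wave G t p q)"
  defines "x \<equiv> start_value t p q 0" and "y \<equiv> start_deriv t p q 0"
  shows "wave G t p q = mode t x y" "closes_up t x y"
proof -
  note step = assms(1)[unfolded wave_vertex_conditions_iff, rule_format]
  have start: "start_value t p q i = unrolled_value t x y i \<and> start_deriv t p q i = unrolled_deriv t x y i"
    if "i < N" for i
    using that
  proof (induction i)
    case 0
    show ?case by (simp add: x_def y_def)
  next
    case (Suc i)
    then have "next_index i = Suc i" by (simp add: next_index_def)
    then show ?case using step[of i] Suc by (simp add: unrolled_Suc)
  qed
  have "next_index (N - 1) = 0" "N - 1 < N" "Suc (N - 1) = N" using N3 by (auto simp: next_index_def)
  then show "closes_up t x y"
    using step[of "N - 1"] start[of "N - 1"] unrolled_Suc[of t x y "N - 1"]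
    by (simp add: closes_up_def x_def y_def)
  show "wave G t p q = mode t x y"
    unfolding mode_def
  proof (rule wave_cong)
    fix e assume "e \<in> edges G"
    then obtain i where i: "i < N" "e = cycle_edge i" using edges_eq by auto
    have inv: "the_inv_into {..<N} cycle_edge e = i"
      unfolding i(2) by (rule the_inv_into_f_f[OF inj_cycle_edge]) (use i in simp)
    show "p e = mode_value t x y e \<and> q e = mode_deriv t x y e"
      unfolding mode_value_def mode_deriv_def inv Let_def
        conjunct1[OF start[OF i(1)], symmetric] conjunct2[OF start[OF i(1)], symmetric]
      by (simp add: start_value_def start_deriv_def Let_def i(2)[symmetric] reflection_involutive)
  qed
qed

lemma eigenspace_eq_modes: "anti_standard_eigenspace G t = {mode t x y | x y. closes_up t x y}"
proof -
  have "anti_standard_eigenspace G t = {wave G t p q | p q. vertex_conditions G (wave G t p q)}"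
    by (rule anti_standard_eigenspace_eq_waves[OF edge_len_pos])
  also have "\<dots> = {mode t x y | x y. closes_up t x y}"
  proof (intro equalityI subsetI)
    fix f assume "f \<in> {wave G t p q | p q. vertex_conditions G (wave G t p q)}"
    then show "f \<in> {mode t x y | x y. closes_up t x y}" using wave_is_mode by blast
  next
    fix f assume "f \<in> {mode t x y | x y. closes_up t x y}"
    then show "f \<in> {wave G t p q | p q. vertex_conditions G (wave G t p q)}"
      using mode_vertex_conditions unfolding mode_def by blast
  qed
  finally show ?thesis .
qed

lemma mode_linear:
  "mode t x y = graph_fun_scale x (mode t 1 0) + graph_fun_scale y (mode t 0 1)"
proof -
  have "unrolled_value t x y i = x * unrolled_value t 1 0 i + y * unrolled_value t 0 1 i"
    "unrolled_deriv t x y i = x * unrolled_deriv t 1 0 i + y * unrolled_deriv t 0 1 i" for i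
    by (simp_all add: unrolled_value_def unrolled_deriv_def algebra_simps)
  then have "mode_value t x y e = x * mode_value t 1 0 e + y * mode_value t 0 1 e"
    "mode_deriv t x y e = x * mode_deriv t 1 0 e + y * mode_deriv t 0 1 e" for e
    by (simp_all add: mode_value_def mode_deriv_def Let_def algebra_simps)
  then show ?thesis
    by (auto simp: mode_def wave_def graph_fun_scale_def fun_eq_iff algebra_simps)
qed

lemma mode_eq_0_iff: "mode t x y = 0 \<longleftrightarrow> x = 0 \<and> y = 0"
proof
  assume 0: "mode t x y = 0"
  \<comment> \<open>Written as a wave, the zero function too has its boundary data given by
    \<open>wave_values\<close>.\<close>
  have w0: "wave G t (\<lambda>_. 0) (\<lambda>_. 0) = 0" by (auto simp: wave_def fun_eq_iff)
  have "0 < N" using N3 by simp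
  have "vertex_value G (mode t x y) (c 0) (cycle_edge 0) = x" "outgoing_deriv G (mode t x y) (c 0) (cycle_edge 0) = y"
    unfolding mode_def by (simp_all add: wave_values[OF \<open>0 < N\<close>] start_mode[OF \<open>0 < N\<close>])
  moreover have "vertex_value G 0 (c 0) (cycle_edge 0) = 0" "outgoing_deriv G 0 (c 0) (cycle_edge 0) = 0"
    unfolding w0[symmetric]
    by (simp_all add: wave_values[OF \<open>0 < N\<close>] start_value_def start_deriv_def)
  ultimately show "x = 0 \<and> y = 0" using 0 by simp
next
  assume "x = 0 \<and> y = 0"
  then show "mode t x y = 0"
    using mode_linear[of t x y] by (simp add: graph_fun_scale_def fun_eq_iff)
qed

text \<open>\<open>(x, y)\<close> must be an eigenvector of the transfer matrix over the total
  length, for the eigenvalue \<open>\<sigma> = (- 1) ^ N\<close>. The characteristic determinant is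
  \<open>2 - 2 * (C * \<sigma>)\<close>, zero exactly for \<open>C = \<sigma>\<close>. Then
  \<open>t * S * S = 0\<close>: for \<open>t \<noteq> 0\<close> the matrix is scalar, while for
  \<open>t = 0\<close> the entry \<open>S\<close> is the total length and forces
  \<open>y = 0\<close>.\<close>

lemma closes_up_iff:
  "closes_up t x y \<longleftrightarrow> (if cos_sol t (real N * l) = (- 1) ^ N then t = 0 \<longrightarrow> y = 0 else x = 0 \<and> y = 0)"
proof -
  define \<sigma> :: complex where "\<sigma> = (- 1) ^ N"
  let ?C = "cos_sol t (real N * l)" and ?S = "sin_sol t (real N * l)"
  have \<sigma>: "\<sigma> * \<sigma> = 1" "\<sigma> = 1 \<or> \<sigma> = - 1"
    by (cases "even N"; simp add: \<sigma>_def)+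
  have id: "?C * ?C + complex_of_real t * (?S * ?S) = 1" by (rule cos_sin_sol_identity)
  have cl: "closes_up t x y \<longleftrightarrow> x * (?C - \<sigma>) + y * ?S = 0 \<and> y * (?C - \<sigma>) - complex_of_real t * x * ?S = 0"
    using \<sigma>(2)
  proof
    assume "\<sigma> = 1"
    then show ?thesis
      unfolding closes_up_def unrolled_value_def unrolled_deriv_def \<sigma>_def[symmetric]
        eq_iff_diff_eq_0[of "_ * _" x] eq_iff_diff_eq_0[of "_ * _" y]
      by (simp add: algebra_simps)
  next
    assume s: "\<sigma> = - 1"
    have "closes_up t x y \<longleftrightarrow> x = - (x * ?C + y * ?S) \<and> y = - (y * ?C - complex_of_real t * x * ?S)"
      using s by (auto simp: closes_up_def unrolled_value_def unrolled_deriv_def \<sigma>_def[symmetric])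
    also have "\<dots> \<longleftrightarrow> x * (?C - \<sigma>) + y * ?S = 0 \<and> y * (?C - \<sigma>) - complex_of_real t * x * ?S = 0"
      unfolding eq_neg_iff_add_eq_0 s by (simp add: algebra_simps)
    finally show ?thesis .
  qed
  have L: "0 < real N * l" using N3 l_pos by simp
  show ?thesis
  proof (cases "?C = \<sigma>")
    case True
    show ?thesis
    proof (cases "t = 0")
      case True
      then have "?S \<noteq> 0" using N3 l_pos by (simp add: sin_sol_def)
      then show ?thesis using cl \<open>?C = \<sigma>\<close> True by (simp add: \<sigma>_def)
    next
      case False
      then have "?S = 0" using id True \<sigma>(1) by simp
      then show ?thesis using cl \<open>?C = \<sigma>\<close> False by (simp add: \<sigma>_def)
    qed
  next
    case False
    have "x = 0 \<and> y = 0" if "closes_up t x y"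
    proof -
      \<comment> \<open>The determinant of the system \<open>eqs\<close>; the identities for
        \<open>x * ?D\<close> and \<open>y * ?D\<close> are Cramer's rule.\<close>
      let ?D = "2 - 2 * (?C * \<sigma>)"
      have eqs: "x * (?C - \<sigma>) + y * ?S = 0" "y * (?C - \<sigma>) - complex_of_real t * x * ?S = 0"
        using that cl by auto
      have D: "(?C - \<sigma>) * (?C - \<sigma>) + complex_of_real t * (?S * ?S) = ?D"
        using id \<sigma>(1) by (simp add: algebra_simps)
      have "x * ?D = (x * (?C - \<sigma>) + y * ?S) * (?C - \<sigma>) - (y * (?C - \<sigma>) - complex_of_real t * x * ?S) * ?S"
        unfolding D[symmetric] by (simp add: algebra_simps)
      moreover have "y * ?D = (y * (?C - \<sigma>) - complex_of_real t * x * ?S) * (?C - \<sigma>)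
          + complex_of_real t * ((x * (?C - \<sigma>) + y * ?S) * ?S)"
        unfolding D[symmetric] by (simp add: algebra_simps)
      moreover have "?D \<noteq> 0"
      proof
        assume "?D = 0"
        then have "?C * \<sigma> = 1" by simp
        then have "?C * (\<sigma> * \<sigma>) = \<sigma>" by (simp add: mult.assoc[symmetric])
        with False \<sigma>(1) show False by simp
      qed
      ultimately show ?thesis using eqs by simp
    qed
    moreover have "closes_up t x y" if "x = 0 \<and> y = 0" using that cl by simp
    ultimately show ?thesis using False by (auto simp: \<sigma>_def)
  qed
qed

text \<open>\<open>(x, y)\<close> are faithful linear coordinates for modes, so the dimension is
  that of the solution set in \<open>closes_up_iff\<close>.\<close>

lemma eigenspace_dim:
  "\<exists>B. finite B \<and> anti_standard_eigenspace G t \<subseteq> graph_fun.span B"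
  "graph_fun.dim (anti_standard_eigenspace G t) =
    (if cos_sol t (real N * l) = (- 1) ^ N then if t = 0 then 1 else 2 else 0)"
proof -
  let ?u = "mode t 1 0" and ?v = "mode t 0 1"
  have lin: "mode t x y = graph_fun_scale x ?u + graph_fun_scale y ?v" for x y by (rule mode_linear)
  have span: "graph_fun.span {?u, ?v} = {mode t x y | x y. True}"
    by (subst lin) (auto simp: graph_fun.span_insert graph_fun.span_singleton diff_eq_eq add.commute; metis)
  have u_ne: "?u \<noteq> 0" "?v \<noteq> 0" by (simp_all add: mode_eq_0_iff)
  have "?u \<notin> graph_fun.span {?v}"
  proof
    assume "?u \<in> graph_fun.span {?v}"
    then obtain k where "?u = graph_fun_scale k ?v" by (auto simp: graph_fun.span_singleton)
    then have "mode t 1 (- k) = 0" by (subst lin) (simp add: graph_fun_scale_def fun_eq_iff)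
    then show False by (simp add: mode_eq_0_iff)
  qed
  then have indep: "graph_fun.independent {?u, ?v}" and "?u \<noteq> ?v"
    using u_ne by (auto simp: graph_fun.independent_insert graph_fun.dependent_single graph_fun.span_base)
  show "\<exists>B. finite B \<and> anti_standard_eigenspace G t \<subseteq> graph_fun.span B"
    by (intro exI[of _ "{?u, ?v}"]) (auto simp: span eigenspace_eq_modes)
  show "graph_fun.dim (anti_standard_eigenspace G t) =
    (if cos_sol t (real N * l) = (- 1) ^ N then if t = 0 then 1 else 2 else 0)"
  proof (cases "cos_sol t (real N * l) = (- 1) ^ N")
    case False
    then have "anti_standard_eigenspace G t = {0}"
      by (auto simp: eigenspace_eq_modes closes_up_iff mode_eq_0_iff)
    then show ?thesis using False graph_fun.dim_span_eq_card_independent[of "{}"]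
      by (simp add: graph_fun.independent_empty)
  next
    case True
    show ?thesis
    proof (cases "t = 0")
      case t: True
      have "anti_standard_eigenspace G t = {mode t x 0 | x. True}"
        using True t by (auto simp: eigenspace_eq_modes closes_up_iff)
      also have "\<dots> = graph_fun.span {?u}"
        by (subst lin) (auto simp: graph_fun.span_singleton graph_fun_scale_def fun_eq_iff)
      finally show ?thesis
        using True t u_ne graph_fun.dim_span_eq_card_independent[of "{?u}"]
        by (simp add: graph_fun.dependent_single)
    next
      case t: False
      have "anti_standard_eigenspace G t = graph_fun.span {?u, ?v}"
        using True t unfolding span by (auto simp: eigenspace_eq_modes closes_up_iff)
      then show ?thesis
        using True t \<open>?u \<noteq> ?v\<close> graph_fun.dim_span_eq_card_independent[OF indep] by simp
    qed
  qed
qed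

end

section \<open>The eigenvalues in nondecreasing order\<close>

text \<open>At the first index \<open>k\<close> of disagreement let \<open>s k\<close> be the
  smaller value. Then \<open>s'\<close> takes this value only before \<open>k\<close>, where both
  sequences agree, whereas \<open>s\<close> takes it at \<open>k\<close> as well, so the
  multiplicities differ.\<close>

lemma eigenvalue_seq_unique:
  assumes s: "anti_standard_eigenvalue_seq G s" and s': "anti_standard_eigenvalue_seq G s'"
    and "1 \<le> k"
  shows "s k = s' k"
proof -
  have le: "s' k \<le> s k"
    if eq: "\<forall>j<k. 1 \<le> j \<longrightarrow> s j = s' j" and "1 \<le> k"
      and s: "anti_standard_eigenvalue_seq G s" and s': "anti_standard_eigenvalue_seq G s'" for k s s'
  proof (rule ccontr)
    assume "\<not> s' k \<le> s k"
    define t where "t = s k"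
    have fin: "finite {j. 1 \<le> j \<and> s j = t}" using s by (simp add: anti_standard_eigenvalue_seq_def)
    have "{j. 1 \<le> j \<and> s' j = t} \<subset> {j. 1 \<le> j \<and> s j = t}"
    proof
      show "{j. 1 \<le> j \<and> s' j = t} \<subseteq> {j. 1 \<le> j \<and> s j = t}"
      proof
        fix j assume j: "j \<in> {j. 1 \<le> j \<and> s' j = t}"
        have "j < k"
        proof (rule ccontr)
          assume "\<not> j < k"
          then have "s' k \<le> s' j"
            using s' j \<open>1 \<le> k\<close> by (auto simp: anti_standard_eigenvalue_seq_def mono_on_def)
          with j \<open>\<not> s' k \<le> s k\<close> show False by (simp add: t_def)
        qed
        with j eq show "j \<in> {j. 1 \<le> j \<and> s j = t}" by auto
      qed
      have "k \<in> {j. 1 \<le> j \<and> s j = t}" "k \<notin> {j. 1 \<le> j \<and> s' j = t}"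
        using \<open>1 \<le> k\<close> \<open>\<not> s' k \<le> s k\<close> by (auto simp: t_def)
      then show "{j. 1 \<le> j \<and> s' j = t} \<noteq> {j. 1 \<le> j \<and> s j = t}" by blast
    qed
    then have "card {j. 1 \<le> j \<and> s' j = t} < card {j. 1 \<le> j \<and> s j = t}"
      by (rule psubset_card_mono[OF fin])
    moreover have "card {j. 1 \<le> j \<and> s' j = t} = card {j. 1 \<le> j \<and> s j = t}"
      using s s' by (simp add: anti_standard_eigenvalue_seq_def)
    ultimately show False by simp
  qed
  show ?thesis using \<open>1 \<le> k\<close>
  proof (induction k rule: less_induct)
    case (less k)
    then have "\<forall>j<k. 1 \<le> j \<longrightarrow> s j = s' j" "\<forall>j<k. 1 \<le> j \<longrightarrow> s' j = s j" by auto
    from le[OF this(1) less.prems s s'] le[OF this(2) less.prems s' s] show ?case by simp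
  qed
qed

lemma anti_standard_eigenvalue_eqI:
  assumes "anti_standard_eigenvalue_seq G s" "1 \<le> k"
  shows "anti_standard_eigenvalue G k = s k"
  unfolding anti_standard_eigenvalue_def
  by (rule eigenvalue_seq_unique[OF someI[of "anti_standard_eigenvalue_seq G"] assms(1,2)])
    (rule assms(1))

lemma scaled_square_eq_iff:
  assumes "0 < L" "0 \<le> a" "0 \<le> b"
  shows "(a * pi / L)\<^sup>2 = (b * pi / L)\<^sup>2 \<longleftrightarrow> a = b"
proof -
  have "(a * pi / L)\<^sup>2 = (b * pi / L)\<^sup>2 \<longleftrightarrow> a * pi / L = b * pi / L"
    using assms by (intro power2_eq_iff_nonneg) auto
  also have "\<dots> \<longleftrightarrow> a = b" using assms by (simp add: field_simps)
  finally show ?thesis .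
qed

context cycle_graph
begin

lemma total_len_pos: "0 < real N * l"
  using N3 l_pos by simp

text \<open>All eigenvalues are double, and the one with parameter \<open>m\<close> occupies the
  positions \<open>2 * m + 1\<close> and \<open>2 * m + 2\<close>.\<close>

lemma odd_eigenvalue:
  assumes "odd N" "1 \<le> k"
  shows "anti_standard_eigenvalue G k = ((2 * real ((k - 1) div 2) + 1) * pi / (real N * l))\<^sup>2"
proof -
  let ?s = "\<lambda>k. ((2 * real ((k - 1) div 2) + 1) * pi / (real N * l))\<^sup>2"
  have "anti_standard_eigenvalue_seq G ?s"
    unfolding anti_standard_eigenvalue_seq_def
  proof (intro conjI allI)
    show "mono_on {1..} ?s"
    proof (rule mono_onI)
      fix i j :: nat assume "i \<le> j"
      then have "(i - 1) div 2 \<le> (j - 1) div 2" by (intro div_le_mono) simp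
      then show "?s i \<le> ?s j"
        using total_len_pos by (intro power_mono divide_right_mono mult_right_mono) auto
    qed
    fix t
    show "\<exists>B. finite B \<and> anti_standard_eigenspace G t \<subseteq> graph_fun.span B" by (rule eigenspace_dim)
    \<comment> \<open>\<open>cos_sol 0\<close> is constantly 1, so the simple case
      \<open>t = 0\<close> does not occur.\<close>
    have dim: "graph_fun.dim (anti_standard_eigenspace G t) = (if cos_sol t (real N * l) = - 1 then 2 else 0)"
      using \<open>odd N\<close> by (auto simp: eigenspace_dim(2) cos_sol_def)
    have fiber: "{k. 1 \<le> k \<and> ?s k = t} =
        (if \<exists>m::nat. t = ((2 * real m + 1) * pi / (real N * l))\<^sup>2 then
          (let m = (SOME m::nat. t = ((2 * real m + 1) * pi / (real N * l))\<^sup>2) in {2 * m + 1, 2 * m + 2}) else {})"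
    proof (cases "\<exists>m::nat. t = ((2 * real m + 1) * pi / (real N * l))\<^sup>2")
      case True
      define m where "m = (SOME m::nat. t = ((2 * real m + 1) * pi / (real N * l))\<^sup>2)"
      have m: "t = ((2 * real m + 1) * pi / (real N * l))\<^sup>2" unfolding m_def by (rule someI_ex[OF True])
      have "?s k = t \<longleftrightarrow> (k - 1) div 2 = m" for k
        unfolding m using total_len_pos by (subst scaled_square_eq_iff) auto
      then have "{k. 1 \<le> k \<and> ?s k = t} = {k. 1 \<le> k \<and> (k - 1) div 2 = m}" by simp
      also have "\<dots> = {2 * m + 1, 2 * m + 2}" by auto
      finally show ?thesis using True by (simp add: m_def Let_def)
    next
      case False
      then show ?thesis by auto
    qed
    show "finite {k. 1 \<le> k \<and> ?s k = t}" unfolding fiber by (simp add: Let_def)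
    show "card {k. 1 \<le> k \<and> ?s k = t} = graph_fun.dim (anti_standard_eigenspace G t)"
      unfolding fiber dim cos_sol_eq_minus_1_iff[OF total_len_pos] by (simp add: Let_def)
  qed
  then show ?thesis by (rule anti_standard_eigenvalue_eqI[OF _ \<open>1 \<le> k\<close>])
qed

text \<open>The simple eigenvalue 0 takes position 1 alone, which shifts the double ones to the
  positions \<open>2 * m\<close> and \<open>2 * m + 1\<close>.\<close>

lemma even_eigenvalue:
  assumes "even N" "1 \<le> k"
  shows "anti_standard_eigenvalue G k = (2 * real (k div 2) * pi / (real N * l))\<^sup>2"
proof -
  let ?s = "\<lambda>k. (2 * real (k div 2) * pi / (real N * l))\<^sup>2"
  have "anti_standard_eigenvalue_seq G ?s"
    unfolding anti_standard_eigenvalue_seq_def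
  proof (intro conjI allI)
    show "mono_on {1..} ?s"
    proof (rule mono_onI)
      fix i j :: nat assume "i \<le> j"
      then have "i div 2 \<le> j div 2" by (intro div_le_mono) simp
      then show "?s i \<le> ?s j"
        using total_len_pos by (intro power_mono divide_right_mono mult_right_mono) auto
    qed
    fix t
    show "\<exists>B. finite B \<and> anti_standard_eigenspace G t \<subseteq> graph_fun.span B" by (rule eigenspace_dim)
    have dim: "graph_fun.dim (anti_standard_eigenspace G t) =
        (if cos_sol t (real N * l) = 1 then if t = 0 then 1 else 2 else 0)"
      using \<open>even N\<close> by (simp add: eigenspace_dim(2))
    \<comment> \<open>Removing the position 0 leaves a single position for \<open>m = 0\<close>, in
      accordance with the simple eigenvalue 0.\<close>
    have fiber: "{k. 1 \<le> k \<and> ?s k = t} =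
        (if \<exists>m::nat. t = (2 * real m * pi / (real N * l))\<^sup>2 then
          (let m = (SOME m::nat. t = (2 * real m * pi / (real N * l))\<^sup>2) in {2 * m, 2 * m + 1} - {0}) else {})
      \<and> (t = 0 \<longrightarrow> (SOME m::nat. t = (2 * real m * pi / (real N * l))\<^sup>2) = 0)
      \<and> ((\<exists>m::nat. t = (2 * real m * pi / (real N * l))\<^sup>2) \<and> t \<noteq> 0 \<longrightarrow>
          0 < (SOME m::nat. t = (2 * real m * pi / (real N * l))\<^sup>2))"
    proof (cases "\<exists>m::nat. t = (2 * real m * pi / (real N * l))\<^sup>2")
      case True
      define m where "m = (SOME m::nat. t = (2 * real m * pi / (real N * l))\<^sup>2)"
      have m: "t = (2 * real m * pi / (real N * l))\<^sup>2" unfolding m_def by (rule someI_ex[OF True])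
      have "?s k = t \<longleftrightarrow> k div 2 = m" for k
        unfolding m using total_len_pos by (subst scaled_square_eq_iff) auto
      then have "{k. 1 \<le> k \<and> ?s k = t} = {k. 1 \<le> k \<and> k div 2 = m}" by simp
      also have "\<dots> = {2 * m, 2 * m + 1} - {0}" by auto
      finally have "{k. 1 \<le> k \<and> ?s k = t} = {2 * m, 2 * m + 1} - {0}" .
      moreover have "t = 0 \<longleftrightarrow> m = 0" unfolding m using total_len_pos by auto
      ultimately show ?thesis using True by (auto simp: m_def[symmetric] Let_def)
    next
      case False
      moreover have "t \<noteq> 0" using False[unfolded not_ex, rule_format, of 0] by auto
      ultimately show ?thesis by auto
    qed
    show "finite {k. 1 \<le> k \<and> ?s k = t}" unfolding conjunct1[OF fiber] by (simp add: Let_def)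
    have card: "card ({2 * m, 2 * m + 1} - {0}) = (if m = 0 then 1 else 2)" for m :: nat
      by (cases "m = 0") (auto simp: card_insert_if)
    show "card {k. 1 \<le> k \<and> ?s k = t} = graph_fun.dim (anti_standard_eigenspace G t)"
      unfolding conjunct1[OF fiber] dim cos_sol_eq_1_iff[OF total_len_pos]
      using conjunct2[OF fiber] by (auto simp: Let_def card)
  qed
  then show ?thesis by (rule anti_standard_eigenvalue_eqI[OF _ \<open>1 \<le> k\<close>])
qed

text \<open>The two classes alternate along the cycle and must match after \<open>N\<close>
  steps.\<close>

lemma bipartite_imp_even:
  assumes "bipartite G"
  shows "even N"
proof -
  obtain A B where AB: "A \<inter> B = {}" "\<forall>(u, v) \<in> edges G. u \<in> A \<and> v \<in> B \<or> u \<in> B \<and> v \<in> A"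
    using assms unfolding bipartite_def by blast
  have alt: "c (Suc i) \<in> A \<longleftrightarrow> c i \<notin> A" if "i < N" for i
    using cycle_edge_in_edges[OF that] AB by (auto simp: cycle_edge_def split: if_splits)
  have "i \<le> N \<Longrightarrow> c i \<in> A \<longleftrightarrow> (c 0 \<in> A \<longleftrightarrow> even i)" for i
    by (induction i) (use alt in auto)
  from this[of N] c_N show ?thesis by auto
qed

end

lemma cycle_graphI:
  assumes G: "metric_graph G" "is_cycle G" and len: "\<And>e. e \<in> edges G \<Longrightarrow> edge_len G e = l"
  obtains c where "cycle_graph G c (length (vertices G)) l"
proof -
  obtain cs where cs: "3 \<le> length cs" "distinct cs" "set cs = set (vertices G)"
    and adj: "\<forall>u v. adjacent G u v \<longleftrightarrow> (\<exists>i < length cs. {u, v} = {cs ! i, cs ! (Suc i mod length cs)})"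
    using G(2) unfolding is_cycle_def by auto
  have n: "length (vertices G) = length cs"
    using cs(2,3) G(1) by (metis distinct_card metric_graph_def)
  obtain e where "e \<in> edges G" "0 < edge_len G e" using G(1) by (auto simp: metric_graph_def)
  then have "0 < l" using len by simp
  have "cycle_graph G (\<lambda>k. cs ! (k mod length cs)) (length (vertices G)) l"
    unfolding n
  proof
    show "inj_on (\<lambda>k. cs ! (k mod length cs)) {..<length cs}"
      using cs(2) by (auto simp: inj_on_def nth_eq_iff_index_eq)
    show "set (vertices G) = (\<lambda>k. cs ! (k mod length cs)) ` {..<length cs}"
    proof -
      have "(\<lambda>k. cs ! (k mod length cs)) ` {..<length cs} = (\<lambda>k. cs ! k) ` {..<length cs}"
        by (rule image_cong) auto
      then show ?thesis using nth_image[of "length cs" cs] cs(3) by (simp add: lessThan_atLeast0)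
    qed
    show "adjacent G u v \<longleftrightarrow>
        (\<exists>i<length cs. {u, v} = {cs ! (i mod length cs), cs ! (Suc i mod length cs)})" for u v
    proof -
      have "(\<exists>i<length cs. {u, v} = {cs ! i, cs ! (Suc i mod length cs)}) \<longleftrightarrow>
          (\<exists>i<length cs. {u, v} = {cs ! (i mod length cs), cs ! (Suc i mod length cs)})"
        by (rule ex_cong1, rule conj_cong) simp_all
      then show ?thesis using adj by simp
    qed
    show "(v, u) \<notin> edges G" if "(u, v) \<in> edges G" for u v
      using G(1) that by (auto simp: metric_graph_def)
    show "3 \<le> length cs" "0 < l" by fact+
    show "cs ! (length cs mod length cs) = cs ! (0 mod length cs)" by simp
    show "edge_len G e = l" if "e \<in> edges G" for e by (rule len[OF that])
  qed
  then show ?thesis by (rule that)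
qed

section \<open>Subdivision of a cycle\<close>

lemma set_path_steps:
  "(x, y) \<in> set (path_steps p) \<longleftrightarrow> (\<exists>r. Suc r < length p \<and> x = p ! r \<and> y = p ! Suc r)"
  unfolding path_steps_def set_zip by (auto simp: nth_tl less_diff_conv)

lemma sum_list_joining_len:
  assumes "\<And>x y. (x, y) \<in> set (path_steps p) \<Longrightarrow> adjacent H x y"
    and "\<And>e. e \<in> edges H \<Longrightarrow> edge_len H e = l'"
  shows "(\<Sum>s \<leftarrow> path_steps p. joining_len H s) = real (length p - 1) * l'"
proof -
  have "joining_len H s = l'" if "s \<in> set (path_steps p)" for s
  proof -
    obtain u v where s: "s = (u, v)" by (cases s)
    then have "adjacent H u v" using assms(1) that by blast
    then show ?thesis using assms(2) by (auto simp: s joining_len_def adjacent_def)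
  qed
  then have "(\<Sum>s \<leftarrow> path_steps p. joining_len H s) = (\<Sum>s \<leftarrow> path_steps p. l')"
    by (intro arg_cong[of _ _ sum_list] map_cong) auto
  then show ?thesis by (simp add: sum_list_triv path_steps_def)
qed

text \<open>Step \<open>r\<close> of the reversed path is step \<open>length p - 2 - r\<close> of
  the path itself; needed for edges stored against the cycle.\<close>

lemma rev_path_steps_iff:
  "(\<exists>r. Suc r < length p \<and> {x, y} = {rev p ! r, rev p ! Suc r}) \<longleftrightarrow>
   (\<exists>r. Suc r < length p \<and> {x, y} = {p ! r, p ! Suc r})"
proof -
  have *: "\<exists>r. Suc r < length p \<and> {x, y} = {p ! r, p ! Suc r}"
    if ex: "\<exists>r. Suc r < length p \<and> {x, y} = {rev p ! r, rev p ! Suc r}" for p :: "'a list"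
  proof -
    obtain r where r: "Suc r < length p" "{x, y} = {rev p ! r, rev p ! Suc r}" using ex by blast
    have "rev p ! Suc r = p ! (length p - Suc (Suc r))" "rev p ! r = p ! Suc (length p - Suc (Suc r))"
      using r(1) by (simp_all add: rev_nth Suc_diff_Suc)
    then show ?thesis using r by (intro exI[of _ "length p - Suc (Suc r)"]) auto
  qed
  show ?thesis using *[of p] *[of "rev p"] by auto
qed

text \<open>The cycle of the subdivided graph runs through the paths replacing the edges, each of them
  traversed in the direction of the original cycle.\<close>

lemma (in cycle_graph) subdivision_cycle:
  fixes H :: "'w mgraph"
  assumes H: "metric_graph H" "subdivides_each_edge H G"
    and len: "\<And>e. e \<in> edges H \<Longrightarrow> edge_len H e = l'"
  obtains c' m where "cycle_graph H c' (N * m) l'" "real m * l' = l"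
proof -
  obtain \<phi> P where inj: "inj_on \<phi> (set (vertices G))"
    and vert: "set (vertices H) = \<phi> ` set (vertices G) \<union> (\<Union>e \<in> edges G. inner_vertices (P e))"
    and path: "\<forall>e \<in> edges G.
        3 \<le> length (P e) \<and> distinct (P e) \<and>
        hd (P e) = \<phi> (fst e) \<and> last (P e) = \<phi> (snd e) \<and>
        inner_vertices (P e) \<inter> \<phi> ` set (vertices G) = {} \<and>
        edge_len G e = (\<Sum>s \<leftarrow> path_steps (P e). joining_len H s)"
    and disj: "\<forall>e \<in> edges G. \<forall>e' \<in> edges G. e \<noteq> e' \<longrightarrow>
        inner_vertices (P e) \<inter> inner_vertices (P e') = {}"
    and adj: "\<forall>x y. adjacent H x y \<longleftrightarrow>
        (\<exists>e \<in> edges G. (x, y) \<in> set (path_steps (P e)) \<or> (y, x) \<in> set (path_steps (P e)))"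
    using H(2) unfolding subdivides_each_edge_def by (elim exE conjE) (rule that)
  obtain e0 where "e0 \<in> edges H" "0 < edge_len H e0" using H(1) by (auto simp: metric_graph_def)
  then have "0 < l'" using len by simp
  have path_len: "real (length (P e) - 1) * l' = l" if "e \<in> edges G" for e
  proof -
    have "adjacent H x y" if "(x, y) \<in> set (path_steps (P e))" for x y
      using adj \<open>e \<in> edges G\<close> that by blast
    then have "(\<Sum>s \<leftarrow> path_steps (P e). joining_len H s) = real (length (P e) - 1) * l'"
      using len by (rule sum_list_joining_len)
    moreover have "edge_len G e = (\<Sum>s \<leftarrow> path_steps (P e). joining_len H s)"
      using path that by blast
    ultimately show ?thesis using edge_len_eq[OF that] by simp
  qed
  \<comment> \<open>Both graphs being equilateral, all paths have equally many steps, so edge 0 can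
    represent them.\<close>
  define m where "m = length (P (cycle_edge 0)) - 1"
  have "0 < N" using N3 by simp
  have m: "real m * l' = l" unfolding m_def by (rule path_len[OF cycle_edge_in_edges[OF \<open>0 < N\<close>]])
  have length_P: "length (P e) = Suc m" if "e \<in> edges G" for e
  proof -
    have "real (length (P e) - 1) * l' = real m * l'" using path_len[OF that] m by simp
    then have "length (P e) - 1 = m" using \<open>0 < l'\<close> by simp
    moreover have "3 \<le> length (P e)" using path that by blast
    ultimately show ?thesis by simp
  qed
  have "2 \<le> m"
    using path[rule_format, OF cycle_edge_in_edges[OF \<open>0 < N\<close>]]
      length_P[OF cycle_edge_in_edges[OF \<open>0 < N\<close>]] by simp
  define Q where "Q i = (if forward i then P (cycle_edge i) else rev (P (cycle_edge i)))" for i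
  have length_Q: "length (Q i) = Suc m" if "i < N" for i
    using length_P[OF cycle_edge_in_edges[OF that]] by (simp add: Q_def)
  have distinct_Q: "distinct (Q i)" if "i < N" for i
    using path cycle_edge_in_edges[OF that] by (auto simp: Q_def)
  have ends: "Q i ! 0 = \<phi> (c i) \<and> Q i ! m = \<phi> (c (Suc i))" if "i < N" for i
  proof -
    let ?p = "P (cycle_edge i)"
    have p: "hd ?p = \<phi> (fst (cycle_edge i))" "last ?p = \<phi> (snd (cycle_edge i))" "length ?p = Suc m"
      using path length_P cycle_edge_in_edges[OF that] by blast+
    have "?p ! 0 = hd ?p" "?p ! m = last ?p" "rev ?p ! 0 = last ?p" "rev ?p ! m = hd ?p"
      using p(3) by (auto simp: hd_conv_nth last_conv_nth rev_nth simp flip: length_greater_0_conv)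
    with p(1,2) show ?thesis by (cases "forward i") (simp_all add: Q_def cycle_edge_def)
  qed
  have inner: "inner_vertices (P (cycle_edge i)) = (\<lambda>r. Q i ! r) ` {0<..<m}" if "i < N" for i
  proof -
    let ?p = "P (cycle_edge i)"
    have p: "hd ?p = \<phi> (fst (cycle_edge i))" "last ?p = \<phi> (snd (cycle_edge i))"
      using path cycle_edge_in_edges[OF that] by blast+
    have "{hd ?p, last ?p} = {Q i ! 0, Q i ! m}"
      using ends[OF that] p by (cases "forward i") (auto simp: cycle_edge_def)
    moreover have "set ?p = set (Q i)" by (simp add: Q_def)
    moreover have "set (Q i) = (\<lambda>r. Q i ! r) ` {0..<Suc m}"
      using nth_image[of "Suc m" "Q i"] length_Q[OF that] by simp
    ultimately have "inner_vertices ?p = (\<lambda>r. Q i ! r) ` {0..<Suc m} - (\<lambda>r. Q i ! r) ` {0, m}"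
      by (simp add: inner_vertices_def)
    also have "\<dots> = (\<lambda>r. Q i ! r) ` ({0..<Suc m} - {0, m})"
    proof (rule inj_on_image_set_diff[symmetric])
      show "inj_on (\<lambda>r. Q i ! r) {0..<Suc m}"
        using distinct_Q[OF that] length_Q[OF that] by (auto simp: inj_on_def nth_eq_iff_index_eq)
    qed auto
    also have "{0..<Suc m} - {0, m} = {0<..<m}" by auto
    finally show ?thesis .
  qed
  \<comment> \<open>A position is split into the index of a path and the offset on it; the index
    modulo \<open>N\<close> brings \<open>N * m\<close> back to the start.\<close>
  define c' where "c' k = Q (k div m mod N) ! (k mod m)" for k
  \<comment> \<open>The offset \<open>m\<close> is included: the last vertex of a path is the first
    of the next one.\<close>
  have c': "c' (i * m + r) = Q i ! r" if "i < N" "r \<le> m" for i r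
  proof (cases "r < m")
    case True
    then have "(i * m + r) div m = i" "(i * m + r) mod m = r" using \<open>2 \<le> m\<close> by auto
    then show ?thesis using that by (simp add: c'_def)
  next
    case False
    then have "r = m" using that by simp
    then have "(i * m + r) div m = Suc i" "(i * m + r) mod m = 0"
      using \<open>2 \<le> m\<close> by (auto simp: add.commute[of _ m])
    moreover have "c (Suc i mod N) = c (Suc i)" using that c_N by (cases "Suc i = N") auto
    ultimately show ?thesis
      using ends[of "Suc i mod N"] ends[OF that(1)] \<open>0 < N\<close> by (simp add: c'_def \<open>r = m\<close>)
  qed
  have index: "\<exists>i r. k = i * m + r \<and> i < N \<and> r < m" if "k < N * m" for k
    using that \<open>2 \<le> m\<close>
    by (intro exI[of _ "k div m"] exI[of _ "k mod m"]) (auto simp: less_mult_imp_div_less)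
  have index_less: "i * m + r < N * m" if "i < N" "r < m" for i r
  proof -
    have "i * m + r < Suc i * m" using that by simp
    also have "\<dots> \<le> N * m" using that by (intro mult_le_mono1) simp
    finally show ?thesis .
  qed
  have c_vert: "c i \<in> set (vertices G)" if "i < N" for i using that vertices_eq by blast
  have inner_disj: "inner_vertices (P (cycle_edge i)) \<inter> \<phi> ` set (vertices G) = {}" if "i < N" for i
    using path cycle_edge_in_edges[OF that] by blast
  \<comment> \<open>Offset 0 is an original vertex, any other offset below \<open>m\<close> an added
    one; the two kinds never meet, nor do added vertices of different paths.\<close>
  have inj_Q: "i = j \<and> r = s" if eq: "Q i ! r = Q j ! s" and ij: "i < N" "j < N" and rs: "r < m" "s < m" for i j r s
  proof -
    have in_inner: "Q i ! r \<in> inner_vertices (P (cycle_edge i))" if "i < N" "0 < r" "r < m" for i r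
      using inner that by simp
    have zero: "Q i ! 0 \<in> \<phi> ` set (vertices G)" if "i < N" for i
      using ends[OF that] c_vert[OF that] by simp
    consider "r = 0" "s = 0" | "r = 0" "0 < s" | "0 < r" "s = 0" | "0 < r" "0 < s" by blast
    then show ?thesis
    proof cases
      case 1
      then have "\<phi> (c i) = \<phi> (c j)" using eq ends ij by simp
      then have "c i = c j" using inj_onD[OF inj _ c_vert c_vert] ij by blast
      with 1 ij show ?thesis by (simp add: c_eq_iff)
    next
      case 2
      then show ?thesis using eq zero[of i] in_inner[of j s] inner_disj[of j] ij rs by auto
    next
      case 3
      then show ?thesis using eq zero[of j] in_inner[of i r] inner_disj[of i] ij rs by auto
    next
      case 4
      then have "Q i ! r \<in> inner_vertices (P (cycle_edge i)) \<inter> inner_vertices (P (cycle_edge j))"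
        using eq in_inner[of i r] in_inner[of j s] ij rs by simp
      then have "cycle_edge i = cycle_edge j" using disj cycle_edge_in_edges ij by blast
      then have "i = j" using inj_onD[OF inj_cycle_edge] ij by auto
      moreover have "r = s"
        using eq rs distinct_Q[OF ij(1)] length_Q[OF ij(1)] \<open>i = j\<close> by (simp add: nth_eq_iff_index_eq)
      ultimately show ?thesis by simp
    qed
  qed
  have "cycle_graph H c' (N * m) l'"
  proof
    have "3 * 1 \<le> N * m" by (rule mult_le_mono) (use N3 \<open>2 \<le> m\<close> in auto)
    then show "3 \<le> N * m" by simp
    show "0 < l'" by fact
    show "inj_on c' {..<N * m}"
    proof (rule inj_onI)
      fix k k' assume "k \<in> {..<N * m}" "k' \<in> {..<N * m}" and eq: "c' k = c' k'"
      then obtain i r j s where k: "k = i * m + r" "i < N" "r < m" "k' = j * m + s" "j < N" "s < m"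
        using index by (metis lessThan_iff)
      then have "Q i ! r = Q j ! s" using eq by (simp add: c')
      then show "k = k'" using inj_Q k by blast
    qed
    have "c' (N * m) = Q 0 ! 0" using \<open>2 \<le> m\<close> by (simp add: c'_def)
    moreover have "c' 0 = Q 0 ! 0" by (simp add: c'_def)
    ultimately show "c' (N * m) = c' 0" by simp
    show "set (vertices H) = c' ` {..<N * m}"
    proof -
      have "set (vertices H) = (\<Union>i<N. {\<phi> (c i)}) \<union> (\<Union>i<N. (\<lambda>r. Q i ! r) ` {0<..<m})"
        using inner unfolding vert vertices_eq edges_eq by auto
      also have "\<dots> = (\<Union>i<N. (\<lambda>r. Q i ! r) ` {..<m})"
      proof -
        have "{..<m} = insert 0 {0<..<m}" using \<open>2 \<le> m\<close> by auto
        then show ?thesis using ends by auto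
      qed
      also have "\<dots> = c' ` {..<N * m}"
      proof
        show "(\<Union>i<N. (\<lambda>r. Q i ! r) ` {..<m}) \<subseteq> c' ` {..<N * m}"
        proof
          fix x assume "x \<in> (\<Union>i<N. (\<lambda>r. Q i ! r) ` {..<m})"
          then obtain i r where "x = Q i ! r" "i < N" "r < m" by auto
          then show "x \<in> c' ` {..<N * m}"
            using c'[of i r] index_less[of i r] by (intro image_eqI[of _ _ "i * m + r"]) auto
        qed
        show "c' ` {..<N * m} \<subseteq> (\<Union>i<N. (\<lambda>r. Q i ! r) ` {..<m})"
        proof
          fix x assume "x \<in> c' ` {..<N * m}"
          then obtain k where "x = c' k" "k < N * m" by auto
          moreover from this(2) obtain i r where "k = i * m + r" "i < N" "r < m" using index by blast
          ultimately show "x \<in> (\<Union>i<N. (\<lambda>r. Q i ! r) ` {..<m})" using c'[of i r] by auto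
        qed
      qed
      finally show ?thesis .
    qed
    show "adjacent H x y \<longleftrightarrow> (\<exists>k<N * m. {x, y} = {c' k, c' (Suc k)})" for x y
    proof -
      have step: "(x, y) \<in> set (path_steps (P e)) \<or> (y, x) \<in> set (path_steps (P e)) \<longleftrightarrow>
          (\<exists>r. Suc r < length (P e) \<and> {x, y} = {P e ! r, P e ! Suc r})" for e
        unfolding set_path_steps doubleton_eq_iff by blast
      have "(\<exists>r. Suc r < length (P (cycle_edge i)) \<and> {x, y} = {P (cycle_edge i) ! r, P (cycle_edge i) ! Suc r}) \<longleftrightarrow>
          (\<exists>r<m. {x, y} = {c' (i * m + r), c' (Suc (i * m + r))})" if "i < N" for i
      proof -
        have "(\<exists>r. Suc r < length (P (cycle_edge i)) \<and> {x, y} = {P (cycle_edge i) ! r, P (cycle_edge i) ! Suc r}) \<longleftrightarrow>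
            (\<exists>r. Suc r < Suc m \<and> {x, y} = {Q i ! r, Q i ! Suc r})"
          unfolding Q_def using rev_path_steps_iff[of "P (cycle_edge i)" x y] length_P[OF cycle_edge_in_edges[OF that]]
          by simp
        also have "\<dots> \<longleftrightarrow> (\<exists>r<m. {x, y} = {c' (i * m + r), c' (Suc (i * m + r))})"
        proof -
          have "Q i ! r = c' (i * m + r)" "Q i ! Suc r = c' (Suc (i * m + r))" if "r < m" for r
            using c'[OF \<open>i < N\<close>, of r] c'[OF \<open>i < N\<close>, of "Suc r"] that by simp_all
          then show ?thesis by (intro ex_cong1 conj_cong) simp_all
        qed
        finally show ?thesis .
      qed
      then have "adjacent H x y \<longleftrightarrow> (\<exists>i<N. \<exists>r<m. {x, y} = {c' (i * m + r), c' (Suc (i * m + r))})"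
        using adj step unfolding edges_eq by auto
      also have "\<dots> \<longleftrightarrow> (\<exists>k<N * m. {x, y} = {c' k, c' (Suc k)})"
        using index index_less by metis
      finally show ?thesis .
    qed
    show "(v, u) \<notin> edges H" if "(u, v) \<in> edges H" for u v
      using H(1) that by (auto simp: metric_graph_def)
  qed (use len in auto)
  then show ?thesis using m by (rule that)
qed

section \<open>Comparison of the two spectra\<close>

theorem corollary4p2:
  fixes \<Gamma> :: "'v mgraph" and \<Gamma>' :: "'w mgraph" and n :: nat and \<mu> :: "nat \<Rightarrow> real"
  assumes "metric_graph \<Gamma>" and "equilateral \<Gamma>" and "is_cycle \<Gamma>"
    and "n = length (vertices \<Gamma>)" and "odd n"
    and "metric_graph \<Gamma>'" and "equilateral \<Gamma>'" and "bipartite \<Gamma>'"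
    and "subdivides_each_edge \<Gamma>' \<Gamma>"
    and "matrix_eigenvalues_desc (transition_matrix \<Gamma>) \<mu>"
    and "\<forall>j \<in> {2..n}. \<mu> j \<le> - \<mu> (n + 2 - j)"
    and "\<forall>j \<in> {2..n - 2}. \<mu> j \<ge> - \<mu> (n - j)"
  shows "\<forall>k \<ge> 1. anti_standard_eigenvalue \<Gamma>' (k + 1) \<ge> anti_standard_eigenvalue \<Gamma> k"
proof (intro allI impI)
  fix k :: nat assume "1 \<le> k"
  obtain l where l: "\<And>e. e \<in> edges \<Gamma> \<Longrightarrow> edge_len \<Gamma> e = l"
    using assms(2) unfolding equilateral_def by blast
  obtain l' where l': "\<And>e. e \<in> edges \<Gamma>' \<Longrightarrow> edge_len \<Gamma>' e = l'"
    using assms(7) unfolding equilateral_def by blast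
  obtain c where "cycle_graph \<Gamma> c n l"
    using cycle_graphI[OF assms(1,3) l] assms(4) by blast
  then interpret cycle: cycle_graph \<Gamma> c n l .
  obtain c' m where "cycle_graph \<Gamma>' c' (n * m) l'" and m: "real m * l' = l"
    using cycle.subdivision_cycle[OF assms(6,9) l'] by blast
  then interpret cycle': cycle_graph \<Gamma>' c' "n * m" l' by simp
  have total: "real (n * m) * l' = real n * l" using m by (simp add: mult.assoc)
  \<comment> \<open>Subdivision keeps the total length, so only the integer factors of
    \<open>pi / L\<close> are compared. The right side equals
    \<open>2 * ((k - 1) div 2) + 2\<close>: each odd factor lies just below the even one at the
    shifted index.\<close>
  have "2 * ((k - 1) div 2) + 1 \<le> 2 * ((k + 1) div 2)" using \<open>1 \<le> k\<close> by linarith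
  then have "real (2 * ((k - 1) div 2) + 1) \<le> real (2 * ((k + 1) div 2))" by (rule of_nat_mono)
  then have "2 * real ((k - 1) div 2) + 1 \<le> 2 * real ((k + 1) div 2)" by simp
  then have "((2 * real ((k - 1) div 2) + 1) * pi / (real n * l))\<^sup>2 \<le>
      (2 * real ((k + 1) div 2) * pi / (real n * l))\<^sup>2"
    using cycle.total_len_pos by (intro power_mono divide_right_mono mult_right_mono) auto
  moreover have "anti_standard_eigenvalue \<Gamma>' (k + 1) =
      (2 * real ((k + 1) div 2) * pi / (real (n * m) * l'))\<^sup>2"
    by (rule cycle'.even_eigenvalue[OF cycle'.bipartite_imp_even[OF assms(8)]]) simp
  ultimately show "anti_standard_eigenvalue \<Gamma>' (k + 1) \<ge> anti_standard_eigenvalue \<Gamma> k"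
    unfolding total cycle.odd_eigenvalue[OF assms(5) \<open>1 \<le> k\<close>] by (simp only:)
qed

end
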